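(* Let $N\ge2$, and let $$\mathcal{A}_L=e_q(-\check x_0)\,e_q(-\check x_0\check x_1)\cdots e_q(-\check x_0\check x_1\cdots\check x_{N-2})\cdot e_q(-\check x_{N-1})\cdots e_q(-\check x_1)\cdot\varphi(\Lambda),$$ $$\mathcal{A}_R=\varphi(q^{1-N}D_N\Lambda)\cdot e_q(-\hat x_1)\cdots e_q(-\hat x_{N-1})\cdot e_q(-\hat x_{N-2}\cdots\hat x_1\hat x_0)\cdots e_q(-\hat x_1\hat x_0)\,e_q(-\hat x_0).$$ Let $\pi$ be the algebra automorphism given by the cyclic shift $\pi(\check x_i)=\check x_{i+1}$, $\pi(\hat x_i)=\hat x_{i+1}$ ($i\in\mathbb{Z}/N\mathbb{Z}$). Then $$\pi(\mathcal{A}_L)=\mathcal{A}_L,\qquad\pi(\mathcal{A}_R)=\mathcal{A}_R .$$ Consequently the Hamiltonian $$\mathcal{H}=q^{\frac12\Delta}\cdot\mathcal{A}_L\cdot\mathcal{A}_C\cdot\mathcal{A}_R\cdot q^{\frac12\Delta}\cdot\mathsf{T}$$ has the cyclic symmetry in the variables $x_i$: it is unchanged under the simultaneous relabelling $x_i\to x_{i+1}$, $d_i\to d_{i+1}$, $\overline d_i\to\overline d_{i+1}$, $b_i\to b_{i+1}$ (indices mod $N$).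
   Context: Let $0<|q|<1$. Indices $i$ are in $\mathbb{Z}/N\mathbb{Z}$ (so $x_0=x_N$, etc.), $x_1,\dots,x_N$ are commuting variables, $\vartheta_i=x_i\frac{\partial}{\partial x_i}$. Let $b_i,d_i,\overline d_i,\kappa$ be nonzero complex parameters, $D_N=\prod_{k=1}^N d_k\overline d_k$, $\Lambda=x_1x_2\cdots x_N$, and define operators on formal power series in $x_1,\dots,x_N$: $$\hat x_i=d_i\overline d_i\,x_i\,q^{\vartheta_i-\vartheta_{i-1}},\qquad \check x_i=x_i\,q^{-\vartheta_i+\vartheta_{i-1}}.$$ They satisfy $\hat x_i\hat x_j=q^{\delta_{i,j-1}-\delta_{i-1,j}}\hat x_j\hat x_i$ and $\check x_i\check x_j=q^{\delta_{i-1,j}-\delta_{i,j-1}}\check x_j\check x_i$ (Kronecker deltas mod $N$), so $\pi$ is a well-defined automorphism of (the completion by degree of) the algebra generated by the $\hat x_i$, and likewise of that generated by the $\check x_i$. The central elements in $\mathcal{A}_L,\mathcal{A}_R$ are regarded as elements of these algebras via $q^{1-N}D_N\Lambda=\hat x_{N-1}\cdots\hat x_1\hat x_0$ and $q^{N-1}\Lambda=\check x_{N-1}\cdots\check x_1\check x_0$. $\varphi(z)=(z;q)_\infty$ and $e_q(z)=\varphi(z)^{-1}=\sum_{n\ge0}z^n/(q;q)_n$, understood as power series for operator arguments. Moreover $\Delta=\frac12\sum_{i=1}^N(\vartheta_i-\vartheta_{i-1})^2$, $\mathcal{A}_C=\prod_{k=1}^N\frac{1}{\varphi(d_kx_k)\varphi(\overline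 d_kx_k)}$, and $\mathsf{T}$ is the shift operator $x_i\mapsto\frac{\kappa b_i}{b_{i+1}}x_i$ for all $i$. *)

theory Defs
  imports
    "HOL-Complex_Analysis.Complex_Analysis"
    "HOL-Library.Function_Algebras"
    "Berlekamp_Zassenhaus.Finite_Field"
begin

text \<open>
  The index set Z/NZ is the type \<^typ>\<open>'n mod_ring\<close> with N = CARD('n); the class
  \<^class>\<open>nontriv\<close> says N > 1. A formal power series in the variables x_i is
  the function sending an exponent vector to its coefficient. The product of operators is
  composition \<^term>\<open>(\<circ>)\<close>, the rightmost factor acting first; the sum and difference of
  operators are the pointwise ones. The pointwise product of functions is never used on
  operators.
\<close>

type_synonym 'n expo = "'n mod_ring \<Rightarrow> nat"
type_synonym 'n pser = "'n expo \<Rightarrow> complex"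
type_synonym 'n oper = "'n pser \<Rightarrow> 'n pser"

definition degree_expo :: "'n::finite expo \<Rightarrow> nat" where
  "degree_expo m = (\<Sum>i\<in>UNIV. m i)"

definition op_scale :: "complex \<Rightarrow> 'n oper \<Rightarrow> 'n oper" where
  "op_scale c T = (\<lambda>g m. c * T g m)"

definition op_prod :: "'n oper list \<Rightarrow> 'n oper" where
  "op_prod Ts = foldr (\<circ>) Ts id"

definition op_var :: "'n mod_ring \<Rightarrow> 'n oper" where
  "op_var i = (\<lambda>g m. if m i = 0 then 0 else g (m(i := m i - 1)))"

text \<open>
  As \<open>\<vartheta>\<^sub>i\<close> multiplies the monomial with exponent vector m by \<open>m i\<close>, every function of the
  \<open>\<vartheta>\<^sub>i\<close> is a diagonal operator.
\<close>

definition op_diag :: "('n expo \<Rightarrow> complex) \<Rightarrow> 'n oper" where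
  "op_diag c = (\<lambda>g m. c m * g m)"

definition x_check :: "complex \<Rightarrow> 'n::nontriv mod_ring \<Rightarrow> 'n oper" where
  "x_check q i = op_var i \<circ> op_diag (\<lambda>m. q powi (- int (m i) + int (m (i - 1))))"

definition x_hat ::
  "complex \<Rightarrow> ('n::nontriv mod_ring \<Rightarrow> complex) \<Rightarrow> ('n mod_ring \<Rightarrow> complex) \<Rightarrow>
   'n mod_ring \<Rightarrow> 'n oper" where
  "x_hat q d db i =
     op_scale (d i * db i) (op_var i \<circ> op_diag (\<lambda>m. q powi (int (m i) - int (m (i - 1)))))"

text \<open>
  Substitution of an operator into a power series in one variable. For an operator that
  raises degrees by at least 1 (the only case used), all but finitely many terms of the
  series for each coefficient vanish.
\<close>

definition op_series :: "complex fps \<Rightarrow> 'n oper \<Rightarrow> 'n oper" where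
  "op_series F T = (\<lambda>g m. \<Sum>n. fps_nth F n * (T ^^ n) g m)"

definition qpoch_inf :: "complex \<Rightarrow> complex \<Rightarrow> complex" where
  "qpoch_inf q z = (\<Prod>n. 1 - z * q ^ n)"

definition phi_fps :: "complex \<Rightarrow> complex fps" where
  "phi_fps q = fps_expansion (qpoch_inf q) 0"

definition op_phi :: "complex \<Rightarrow> 'n oper \<Rightarrow> 'n oper" where
  "op_phi q T = op_series (phi_fps q) T"

definition op_e :: "complex \<Rightarrow> 'n oper \<Rightarrow> 'n oper" where
  "op_e q T = op_series (inverse (phi_fps q)) T"

definition op_Lambda :: "'n::nontriv oper" where
  "op_Lambda = op_prod (map (\<lambda>k. op_var (of_nat k)) [1..<CARD('n) + 1])"

definition D_N :: "('n::nontriv mod_ring \<Rightarrow> complex) \<Rightarrow> ('n mod_ring \<Rightarrow> complex) \<Rightarrow> complex" where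
  "D_N d db = (\<Prod>k\<in>UNIV. d k * db k)"

definition A_L :: "complex \<Rightarrow> 'n::nontriv oper" where
  "A_L q =
     op_prod (map (\<lambda>k. op_e q (op_scale (-1)
         (op_prod (map (\<lambda>j. x_check q (of_nat j)) [0..<k + 1])))) [0..<CARD('n) - 1])
     \<circ> op_prod (map (\<lambda>k. op_e q (op_scale (-1) (x_check q (of_nat k)))) (rev [1..<CARD('n)]))
     \<circ> op_phi q op_Lambda"

definition A_R ::
  "complex \<Rightarrow> ('n::nontriv mod_ring \<Rightarrow> complex) \<Rightarrow> ('n mod_ring \<Rightarrow> complex) \<Rightarrow> 'n oper" where
  "A_R q d db =
     op_phi q (op_scale (q powi (1 - int CARD('n)) * D_N d db) op_Lambda)
     \<circ> op_prod (map (\<lambda>k. op_e q (op_scale (-1) (x_hat q d db (of_nat k)))) [1..<CARD('n)])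
     \<circ> op_prod (map (\<lambda>k. op_e q (op_scale (-1)
         (op_prod (map (\<lambda>j. x_hat q d db (of_nat j)) (rev [0..<k + 1])))))
         (rev [0..<CARD('n) - 1]))"

definition A_C ::
  "complex \<Rightarrow> ('n::nontriv mod_ring \<Rightarrow> complex) \<Rightarrow> ('n mod_ring \<Rightarrow> complex) \<Rightarrow> 'n oper" where
  "A_C q d db =
     op_prod (map (\<lambda>k. op_e q (op_scale (d (of_nat k)) (op_var (of_nat k)))
                     \<circ> op_e q (op_scale (db (of_nat k)) (op_var (of_nat k))))
       [1..<CARD('n) + 1])"

definition Delta_expo :: "'n::nontriv expo \<Rightarrow> complex" where
  "Delta_expo m = (1/2) * (\<Sum>i\<in>UNIV. (of_nat (m i) - of_nat (m (i - 1))) ^ 2)"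

text \<open>
  The operator with exponent \<open>\<Delta>/2\<close> and base q involves a square root of q; the branch is given by the argument \<open>logq\<close>,
  a logarithm of q.
\<close>

definition op_q_half_Delta :: "complex \<Rightarrow> 'n::nontriv oper" where
  "op_q_half_Delta logq = op_diag (\<lambda>m. exp (logq * ((1/2) * Delta_expo m)))"

definition op_shift :: "complex \<Rightarrow> ('n::nontriv mod_ring \<Rightarrow> complex) \<Rightarrow> 'n oper" where
  "op_shift \<kappa> b = op_diag (\<lambda>m. \<Prod>i\<in>UNIV. (\<kappa> * b i / b (i + 1)) ^ m i)"

definition Hamiltonian ::
  "complex \<Rightarrow> complex \<Rightarrow> complex \<Rightarrow> ('n::nontriv mod_ring \<Rightarrow> complex) \<Rightarrow>
   ('n mod_ring \<Rightarrow> complex) \<Rightarrow> ('n mod_ring \<Rightarrow> complex) \<Rightarrow> 'n oper" where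
  "Hamiltonian q logq \<kappa> b d db =
     op_q_half_Delta logq \<circ> A_L q \<circ> A_C q d db \<circ> A_R q d db
     \<circ> op_q_half_Delta logq \<circ> op_shift \<kappa> b"

inductive_set gen_algebra :: "('n mod_ring \<Rightarrow> 'n oper) \<Rightarrow> 'n oper set"
  for G :: "'n mod_ring \<Rightarrow> 'n oper" where
  gen: "G i \<in> gen_algebra G"
| one: "id \<in> gen_algebra G"
| add: "X \<in> gen_algebra G \<Longrightarrow> Y \<in> gen_algebra G \<Longrightarrow> X + Y \<in> gen_algebra G"
| scale: "X \<in> gen_algebra G \<Longrightarrow> op_scale c X \<in> gen_algebra G"
| mult: "X \<in> gen_algebra G \<Longrightarrow> Y \<in> gen_algebra G \<Longrightarrow> X \<circ> Y \<in> gen_algebra G"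

definition raises_degree :: "nat \<Rightarrow> 'n::finite oper \<Rightarrow> bool" where
  "raises_degree n T \<longleftrightarrow>
     (\<forall>k g. (\<forall>m. degree_expo m < k \<longrightarrow> g m = 0) \<longrightarrow>
            (\<forall>m. degree_expo m < k + n \<longrightarrow> T g m = 0))"

text \<open>
  The completion by degree, realised inside the operators on formal power series: its
  elements are the operators approximated by elements of the algebra modulo terms of
  arbitrarily high degree. For the generators \<^const>\<open>x_check\<close> and \<^const>\<open>x_hat\<close>,
  whose monomials shift exponent vectors and multiply by nonzero factors, an element of the
  algebra raises degrees by n iff it has no terms of degree below n in the generators.
\<close>

definition completed_algebra :: "('n::finite mod_ring \<Rightarrow> 'n oper) \<Rightarrow> 'n oper set" where
  "completed_algebra G = {X. \<forall>n. \<exists>Y\<in>gen_algebra G. raises_degree n (X - Y)}"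

text \<open>The last condition is continuity for the topology given by degree.\<close>

definition cyclic_shift_automorphism ::
  "('n::nontriv mod_ring \<Rightarrow> 'n oper) \<Rightarrow> ('n oper \<Rightarrow> 'n oper) \<Rightarrow> bool" where
  "cyclic_shift_automorphism G p \<longleftrightarrow>
     bij_betw p (completed_algebra G) (completed_algebra G) \<and>
     (\<forall>X\<in>completed_algebra G. \<forall>Y\<in>completed_algebra G. p (X + Y) = p X + p Y) \<and>
     (\<forall>c. \<forall>X\<in>completed_algebra G. p (op_scale c X) = op_scale c (p X)) \<and>
     (\<forall>X\<in>completed_algebra G. \<forall>Y\<in>completed_algebra G. p (X \<circ> Y) = p X \<circ> p Y) \<and>
     p id = id \<and>
     (\<forall>i. p (G i) = G (i + 1)) \<and>
     (\<forall>n. \<exists>k. \<forall>X\<in>completed_algebra G. raises_degree k X \<longrightarrow> raises_degree n (p X))"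

text \<open>
  The substitution of \<open>x\<^bsub>i+1\<^esub>\<close> for \<open>x\<^sub>i\<close> in a power series. Conjugation by it replaces \<open>x\<^sub>i\<close> and
  \<open>\<vartheta>\<^sub>i\<close> by \<open>x\<^bsub>i+1\<^esub>\<close> and \<open>\<vartheta>\<^bsub>i+1\<^esub>\<close> in an operator.
\<close>

definition relabel :: "'n::nontriv oper" where
  "relabel g = (\<lambda>m. g (\<lambda>i. m (i + 1)))"

definition relabel_op :: "'n::nontriv oper \<Rightarrow> 'n oper" where
  "relabel_op T = relabel \<circ> T \<circ> inv_into UNIV relabel"

end

theory Submission
  imports Defs
begin

text \<open>
  The series \<open>e\<^sub>q\<close> satisfies \<open>e\<^sub>q (q z) = (1 - z) e\<^sub>q z\<close>. If \<open>Y X = q X Y\<close>, this gives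
  \<open>Y e\<^sub>q(X) = e\<^sub>q(X) (Y - X Y)\<close>, and together with \<open>e\<^sub>q(X + Y) = e\<^sub>q(X) e\<^sub>q(Y)\<close> it yields the
  pentagon identity \<open>e\<^sub>q(Y) e\<^sub>q(X) = e\<^sub>q(X) e\<^sub>q(- X Y) e\<^sub>q(Y)\<close>.

  A product of generators with consecutive indices \<open>q\<close>-commutes with the product that continues it
  and commutes with the products nested in it, apart from it or complementary to it. In
  \<open>A\<^sub>L\<close>, the pentagon identity moves the factor of \<open>x\<^bsub>N-1\<^esub>\<close> to the front, which
  prepends \<open>x\<^bsub>N-1\<^esub>\<close> to the words starting at \<open>x\<^sub>0\<close> and leaves a copy of each old word behind. By
  the pentagon identity again, these copies and the remaining factors of single generators merge
  into the factors of single generators of the rotated product. For \<open>A\<^sub>R\<close> the same computation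
  applies in the opposite monoid.

  The automorphism \<open>\<pi>\<close> is realised as conjugation by the relabelling of the variables, combined
  with a rescaling of the variables for the hatted generators. By continuity, every automorphism
  with the required properties agrees with this one on the completed algebra.
\<close>

unbundle no vec_syntax
unbundle fps_syntax

section \<open>The coefficients of the quantum exponential\<close>

lemma qpoch_inf_convergent_prod:
  fixes q z :: complex
  assumes "norm q < 1"
  shows "convergent_prod (\<lambda>n. 1 - z * q ^ n)"
proof -
  have "summable (\<lambda>n. norm z * norm q ^ n)"
    using assms by (intro summable_mult summable_geometric) simp
  then have "abs_convergent_prod (\<lambda>n. 1 - z * q ^ n)"
    by (simp add: abs_convergent_prod_conv_summable norm_mult norm_power)
  then show ?thesis
    by (rule abs_convergent_prod_imp_convergent_prod)
qed

text \<open>The factor with \<open>n = 0\<close> splits off. The bound on \<open>z\<close> keeps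
  this factor nonzero; the unit disc is enough, because only Taylor coefficients at 0 are compared
  later.\<close>

lemma qpoch_inf_functional_equation:
  assumes "norm q < 1" "norm z < 1"
  shows "qpoch_inf q z = (1 - z) * qpoch_inf q (q * z)"
proof -
  have nz: "z * q ^ n \<noteq> 1" for n
  proof
    assume "z * q ^ n = 1"
    moreover have "norm z * norm q ^ n < 1"
      using assms mult_left_le[of "norm q ^ n" "norm z"] by (simp add: power_le_one)
    ultimately show False
      by (metis norm_mult norm_one norm_power order_less_irrefl)
  qed
  have "qpoch_inf q z = (1 - z * q ^ 0) * (\<Prod>n. 1 - z * q ^ Suc n)"
    unfolding qpoch_inf_def
    using prodinf_split_head[OF qpoch_inf_convergent_prod[OF assms(1)], of z] nz[of 0] by simp
  then show ?thesis
    by (simp add: qpoch_inf_def mult_ac)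
qed

text \<open>The partial products converge locally uniformly: in the unit disc the n-th factor
  differs from 1 by at most \<open>norm q ^ n\<close>, so the M-test applies.\<close>

lemma qpoch_inf_holomorphic:
  assumes "norm q < 1"
  shows "qpoch_inf q holomorphic_on ball 0 1"
proof (rule holomorphic_uniform_sequence)
  show "(\<lambda>z. \<Prod>n<N. 1 - z * q ^ n) holomorphic_on ball 0 1" for N
    by (intro holomorphic_intros)
  fix x :: complex
  assume x: "x \<in> ball 0 1"
  then obtain r where r: "r > 0" "cball x r \<subseteq> ball 0 1"
    using open_contains_cball[of "ball 0 (1::real) :: complex set"] by (meson open_ball)
  have "uniformly_convergent_on (cball x r) (\<lambda>N z. \<Prod>n<N. 1 - z * q ^ n)"
  proof (rule uniformly_convergent_on_prod')
    show "uniformly_convergent_on (cball x r) (\<lambda>N z. \<Sum>n<N. norm (1 - z * q ^ n - 1))"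
    proof (rule Weierstrass_m_test')
      fix n z
      assume "z \<in> cball x r"
      with r have "norm z \<le> 1" by (meson less_imp_le mem_ball_0 subsetD)
      then show "norm (norm (1 - z * q ^ n - 1)) \<le> norm q ^ n"
        by (simp add: norm_mult norm_power mult_le_cancel_right1 mult_left_le_one_le)
    qed (use assms in \<open>simp add: summable_geometric\<close>)
  qed (auto intro!: continuous_intros)
  then obtain g where g: "uniform_limit (cball x r) (\<lambda>N z. \<Prod>n<N. 1 - z * q ^ n) g sequentially"
    by (auto simp: uniformly_convergent_on_def)
  have "g z = qpoch_inf q z" if "z \<in> cball x r" for z
  proof (rule LIMSEQ_unique)
    \<comment> \<open>The upper bound \<open>Suc N\<close> matches
      \<open>convergent_prod_LIMSEQ\<close>, whose partial products include the last index.\<close>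
    show "(\<lambda>N. \<Prod>n<Suc N. 1 - z * q ^ n) \<longlonglongrightarrow> g z"
      using tendsto_uniform_limitI[OF g that] by (rule LIMSEQ_Suc)
    show "(\<lambda>N. \<Prod>n<Suc N. 1 - z * q ^ n) \<longlonglongrightarrow> qpoch_inf q z"
      using convergent_prod_LIMSEQ[OF qpoch_inf_convergent_prod[OF assms]]
      by (simp add: qpoch_inf_def lessThan_Suc_atMost)
  qed
  then have "uniform_limit (cball x r) (\<lambda>N z. \<Prod>n<N. 1 - z * q ^ n) (qpoch_inf q) sequentially"
    by (rule iffD1[OF uniform_limit_cong'[OF refl] g])
  with r show "\<exists>d>0. cball x d \<subseteq> ball 0 1 \<and>
      uniform_limit (cball x d) (\<lambda>N z. \<Prod>n<N. 1 - z * q ^ n) (qpoch_inf q) sequentially"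
    by blast
qed simp

text \<open>The functional equation of the infinite product, read off on Taylor series. The series
  with coefficients \<open>q ^ n * phi_fps q $ n\<close> is the substitution of \<open>q * z\<close>
  for \<open>z\<close>.\<close>

lemma phi_fps_functional_equation:
  assumes "norm q < 1"
  shows "phi_fps q = (1 - fps_X) * Abs_fps (\<lambda>n. q ^ n * phi_fps q $ n)"
proof -
  have F: "qpoch_inf q has_fps_expansion phi_fps q"
    unfolding phi_fps_def using qpoch_inf_holomorphic[OF assms]
    by (intro has_fps_expansion_fps_expansion[of "ball 0 1"]) auto
  have "(qpoch_inf q \<circ> (\<lambda>z. q * z)) has_fps_expansion fps_compose (phi_fps q) (fps_const q * fps_X)"
    by (intro has_fps_expansion_compose[OF F]) (auto intro!: fps_expansion_intros)
  then have "(\<lambda>z. (1 - z) * (qpoch_inf q \<circ> (\<lambda>z. q * z)) z)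
      has_fps_expansion (1 - fps_X) * fps_compose (phi_fps q) (fps_const q * fps_X)"
    by (rule has_fps_expansion_mult[rotated]) (intro fps_expansion_intros)
  moreover have ev: "eventually (\<lambda>z. (1 - z) * (qpoch_inf q \<circ> (\<lambda>z. q * z)) z = qpoch_inf q z) (nhds 0)"
    using eventually_nhds_in_open[of "ball 0 1" "0::complex"]
    by (rule eventually_mono) (auto simp: qpoch_inf_functional_equation[OF assms])
  ultimately have "qpoch_inf q has_fps_expansion (1 - fps_X) * fps_compose (phi_fps q) (fps_const q * fps_X)"
    by (intro iffD1[OF has_fps_expansion_cong[OF ev refl]])
  with F show ?thesis
    by (simp add: fps_expansion_unique_complex fps_compose_linear)
qed

lemma phi_fps_nth_0: "phi_fps q $ 0 = 1"
  by (simp add: phi_fps_def fps_expansion_def qpoch_inf_def)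

text \<open>Comparison of coefficients in (1 - z) e(z) = e(q z). This recursion characterises the
  coefficients 1/(q;q)_n, and all later computations use it in place of the closed form.\<close>

lemma e_fps_nth_Suc:
  assumes "norm q < 1"
  shows "(1 - q ^ Suc n) * inverse (phi_fps q) $ Suc n = inverse (phi_fps q) $ n"
proof -
  let ?P = "phi_fps q" and ?E = "inverse (phi_fps q)"
  let ?Pq = "Abs_fps (\<lambda>n. q ^ n * ?P $ n)" and ?Eq = "Abs_fps (\<lambda>n. q ^ n * ?E $ n)"
  have nz: "?P $ 0 \<noteq> 0"
    by (simp add: phi_fps_nth_0)
  have PE: "?P * ?E = 1"
    using nz by (rule inverse_mult_eq_1')
  have "?Pq * ?Eq = fps_compose (?P * ?E) (fps_const q * fps_X)"
    unfolding fps_compose_linear[symmetric] by (rule fps_compose_mult_distrib[symmetric]) simp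
  then have PEq: "?Pq * ?Eq = 1"
    by (simp add: PE fps_compose_1)
  \<comment> \<open>Inserting \<open>?Pq * ?Eq = 1\<close> and regrouping lets the functional
    equation rebuild \<open>?P\<close>, which cancels against \<open>?E\<close>.\<close>
  have "(1 - fps_X) * ?E = (1 - fps_X) * ?E * (?Pq * ?Eq)"
    by (simp add: PEq)
  also have "\<dots> = (((1 - fps_X) * ?Pq) * ?E) * ?Eq"
    by (simp only: mult_ac)
  also have "\<dots> = ?Eq"
    by (simp flip: phi_fps_functional_equation[OF assms] add: PE)
  finally have "((1 - fps_X) * ?E) $ Suc n = ?Eq $ Suc n"
    by simp
  then show ?thesis
    by (simp add: algebra_simps)
qed

section \<open>Power series in operators\<close>

text \<open>Operators are arbitrary functions on power series here, so the linearity needed to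
  distribute a left factor over sums and scalars is carried as a predicate.\<close>

definition linear_oper :: "'n oper \<Rightarrow> bool" where
  "linear_oper T \<longleftrightarrow> (\<forall>f g. T (f + g) = T f + T g) \<and> (\<forall>c g. T (\<lambda>m. c * g m) = (\<lambda>m. c * T g m))"

lemma linear_oper_add: "linear_oper T \<Longrightarrow> T (f + g) = T f + T g"
  and linear_oper_scale: "linear_oper T \<Longrightarrow> T (\<lambda>m. c * g m) = (\<lambda>m. c * T g m)"
  by (auto simp: linear_oper_def)

lemma linear_oper_diff: "linear_oper T \<Longrightarrow> T (f - g) = T f - T g"
  using linear_oper_add[of T f "\<lambda>m. -1 * g m"] linear_oper_scale[of T "-1" g]
  by (simp add: fun_eq_iff plus_fun_def fun_diff_def)

lemma linear_oper_zero: "linear_oper T \<Longrightarrow> T 0 = 0"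
  using linear_oper_diff[of T 0 0] by simp

lemma linear_oper_sum:
  assumes "linear_oper T"
  shows "T (\<lambda>m. \<Sum>i\<in>I. c i * f i m) = (\<lambda>m. \<Sum>i\<in>I. c i * T (f i) m)"
proof (induction I rule: infinite_finite_induct)
  case (insert x F)
  then have "T (\<lambda>m. \<Sum>i\<in>insert x F. c i * f i m)
      = T ((\<lambda>m. c x * f x m) + (\<lambda>m. \<Sum>i\<in>F. c i * f i m))"
    by (simp add: plus_fun_def)
  also have "\<dots> = (\<lambda>m. c x * T (f x) m) + (\<lambda>m. \<Sum>i\<in>F. c i * T (f i) m)"
    by (simp only: linear_oper_add[OF assms] linear_oper_scale[OF assms] insert)
  finally show ?case
    using insert by (simp add: plus_fun_def)
qed (use linear_oper_zero[OF assms] in \<open>simp_all add: zero_fun_def\<close>)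

lemma linear_oper_id [simp]: "linear_oper id"
  and linear_oper_comp: "linear_oper S \<Longrightarrow> linear_oper T \<Longrightarrow> linear_oper (S \<circ> T)"
  and linear_oper_op_scale: "linear_oper T \<Longrightarrow> linear_oper (op_scale c T)"
  and linear_oper_plus: "linear_oper S \<Longrightarrow> linear_oper T \<Longrightarrow> linear_oper (S + T)"
  and linear_oper_minus: "linear_oper S \<Longrightarrow> linear_oper T \<Longrightarrow> linear_oper (S - T)"
  by (simp_all add: linear_oper_def op_scale_def plus_fun_def fun_diff_def algebra_simps)

lemma linear_oper_funpow: "linear_oper T \<Longrightarrow> linear_oper (T ^^ n)"
  by (induction n) (simp_all add: linear_oper_comp)

lemma comp_op_scale: "linear_oper S \<Longrightarrow> S \<circ> op_scale c T = op_scale c (S \<circ> T)"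
  by (simp add: op_scale_def fun_eq_iff linear_oper_scale)

lemma op_scale_comp: "op_scale c S \<circ> T = op_scale c (S \<circ> T)"
  by (simp add: op_scale_def fun_eq_iff)

lemma op_scale_op_scale [simp]: "op_scale c (op_scale d T) = op_scale (c * d) T"
  by (simp add: op_scale_def mult.assoc)

lemma op_scale_1 [simp]: "op_scale 1 T = T"
  by (simp add: op_scale_def)

lemma comp_minus: "linear_oper S \<Longrightarrow> S \<circ> (T - U) = (S \<circ> T) - (S \<circ> U)"
  by (simp add: fun_eq_iff linear_oper_diff)

lemma comp_plus: "linear_oper S \<Longrightarrow> S \<circ> (T + U) = (S \<circ> T) + (S \<circ> U)"
  by (simp add: fun_eq_iff linear_oper_add)

lemma minus_comp: "(S - T) \<circ> U = (S \<circ> U) - (T \<circ> U)"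
  and plus_comp: "(S + T) \<circ> U = (S \<circ> U) + (T \<circ> U)"
  by (simp_all add: fun_eq_iff)

lemma raises_degree_mono: "raises_degree n T \<Longrightarrow> k \<le> n \<Longrightarrow> raises_degree k T"
  unfolding raises_degree_def by (meson add_mono_thms_linordered_semiring(2) order_less_le_trans order_refl)

lemma raises_degree_id: "raises_degree 0 id"
  and raises_degree_plus: "raises_degree n S \<Longrightarrow> raises_degree n T \<Longrightarrow> raises_degree n (S + T)"
  and raises_degree_minus: "raises_degree n S \<Longrightarrow> raises_degree n T \<Longrightarrow> raises_degree n (S - T)"
  and raises_degree_op_scale: "raises_degree n T \<Longrightarrow> raises_degree n (op_scale c T)"
  by (simp_all add: raises_degree_def op_scale_def)

lemma raises_degree_comp: "raises_degree a S \<Longrightarrow> raises_degree b T \<Longrightarrow> raises_degree (a + b) (S \<circ> T)"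
  unfolding raises_degree_def comp_def by (simp add: add.assoc[symmetric] add.commute[of a b]) blast

lemma raises_degree_funpow: "raises_degree 1 T \<Longrightarrow> raises_degree n (T ^^ n)"
  by (induction n) (auto simp: raises_degree_id dest: raises_degree_comp)

lemma raises_degreeD: "raises_degree n T \<Longrightarrow> degree_expo m < n \<Longrightarrow> T g m = 0"
  unfolding raises_degree_def by (metis add.left_neutral not_less0)

text \<open>The topology given by degree is separated: every exponent vector has finite degree, so
  some \<open>n\<close> forces its coefficient in the difference to vanish.\<close>

lemma raises_degree_eqI:
  assumes "\<And>n. raises_degree n (S - T)"
  shows "S = T"
proof (intro ext)
  fix g m
  show "S g m = T g m"
    using raises_degreeD[OF assms, of m "Suc (degree_expo m)" g] by simp
qed

text \<open>The power \<open>T ^^ n\<close> contributes nothing in degrees below \<open>n\<close>.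
  The cutoff \<open>M\<close> is left free so that several series can be truncated at the same
  place.\<close>

lemma op_series_eq_sum:
  assumes "raises_degree 1 T" "degree_expo m < M"
  shows "op_series F T g m = (\<Sum>n<M. F $ n * (T ^^ n) g m)"
  unfolding op_series_def
proof (rule suminf_finite)
  fix n assume "n \<notin> {..<M}"
  then show "F $ n * (T ^^ n) g m = 0"
    using raises_degreeD[OF raises_degree_funpow[OF assms(1)], of m n] assms(2) by simp
qed simp

lemma linear_oper_op_series:
  assumes "raises_degree 1 T" "linear_oper T"
  shows "linear_oper (op_series F T)"
  using linear_oper_funpow[OF assms(2)]
  by (auto simp: linear_oper_def fun_eq_iff op_series_eq_sum[OF assms(1) lessI] algebra_simps
      sum.distrib sum_distrib_left)

text \<open>The tail consists of powers with exponent at least \<open>M\<close>. Hence the partial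
  sums converge to the series in the topology given by degree.\<close>

lemma raises_degree_op_series_minus:
  fixes T :: "'n::finite oper"
  assumes "raises_degree 1 T"
  shows "raises_degree M (op_series F T - (\<lambda>g m. \<Sum>n<M. F $ n * (T ^^ n) g m))"
  unfolding raises_degree_def
proof (intro allI impI)
  fix k and g :: "'n pser" and m :: "'n expo"
  assume g: "\<forall>m. degree_expo m < k \<longrightarrow> g m = 0" and m: "degree_expo m < k + M"
  have "F $ n * (T ^^ n) g m = 0" if "n \<ge> M" for n
    using raises_degree_funpow[OF assms, of n] g m that unfolding raises_degree_def by simp
  \<comment> \<open>The longer cutoff exceeds both \<open>M\<close> and the degree of
    \<open>m\<close>, so the same finite sum computes the series and contains the partial
    sum.\<close>
  then have "(\<Sum>n<M + Suc (degree_expo m). F $ n * (T ^^ n) g m) = (\<Sum>n<M. F $ n * (T ^^ n) g m)"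
    by (intro sum.mono_neutral_right) auto
  then show "(op_series F T - (\<lambda>g m. \<Sum>n<M. F $ n * (T ^^ n) g m)) g m = 0"
    by (simp add: op_series_eq_sum[OF assms, of m "M + Suc (degree_expo m)"])
qed

lemma raises_degree_op_series:
  assumes "raises_degree 1 T"
  shows "raises_degree 0 (op_series F T)"
  using raises_degree_op_series_minus[OF assms, of 0 F] by (simp add: fun_diff_def)

text \<open>Power series pass through left composition because an operator that does not lower degrees
  is determined, up to any degree, by finitely many terms.\<close>

lemma comp_op_series:
  assumes S: "linear_oper S" "raises_degree 0 S" and T: "raises_degree 1 T"
    and degree: "degree_expo m < M"
  shows "(S \<circ> op_series F T) g m = (\<Sum>n<M. F $ n * (S \<circ> T ^^ n) g m)"
proof -
  let ?P = "\<lambda>g m. \<Sum>n<M. F $ n * (T ^^ n) g m"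
  have "raises_degree M (S \<circ> (op_series F T - ?P))"
    using raises_degree_comp[OF S(2) raises_degree_op_series_minus[OF T, of M F]] by simp
  then have "(S \<circ> op_series F T) g m = (S \<circ> ?P) g m"
    using degree raises_degreeD[of M "S \<circ> (op_series F T - ?P)" m g]
    by (simp add: comp_minus[OF S(1)])
  then show ?thesis
    by (simp add: linear_oper_sum[OF S(1)])
qed

text \<open>The relation passes to all powers by induction and then to the series term by term.
  Commutation, the pentagon identity and conjugation of series all rest on this.\<close>

lemma op_series_intertwine:
  assumes S: "linear_oper S" "raises_degree 0 S"
    and T: "raises_degree 1 T" and U: "raises_degree 1 U"
    and eq: "S \<circ> T = U \<circ> S"
  shows "S \<circ> op_series F T = op_series F U \<circ> S"
proof (intro ext)
  fix g m
  have "S \<circ> T ^^ n = U ^^ n \<circ> S" for n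
  proof (induction n)
    case (Suc n)
    have "S \<circ> T ^^ Suc n = (S \<circ> T) \<circ> T ^^ n"
      by (simp only: comp_assoc funpow.simps)
    also have "\<dots> = U ^^ Suc n \<circ> S"
      by (simp only: eq Suc comp_assoc funpow.simps)
    finally show ?case .
  qed simp
  then show "(S \<circ> op_series F T) g m = (op_series F U \<circ> S) g m"
    unfolding comp_op_series[OF S T lessI] by (simp add: op_series_eq_sum[OF U lessI])
qed

text \<open>Intertwining is used twice: first \<open>T\<close> passes the series in
  \<open>S\<close>, then that series passes the series in \<open>T\<close>.\<close>

lemma op_series_commute:
  assumes "raises_degree 1 S" "linear_oper S" "raises_degree 1 T" "linear_oper T"
    and "S \<circ> T = T \<circ> S"
  shows "op_series F S \<circ> op_series G T = op_series G T \<circ> op_series F S"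
proof -
  have "T \<circ> op_series F S = op_series F S \<circ> T"
    using assms raises_degree_mono[of 1 T 0] by (intro op_series_intertwine) simp_all
  then show ?thesis
    by (intro op_series_intertwine linear_oper_op_series raises_degree_op_series assms) simp
qed

section \<open>The pentagon identity\<close>

lemma q_commute_funpow:
  assumes "linear_oper X" and "Y \<circ> X = op_scale q (X \<circ> Y)"
  shows "Y \<circ> X ^^ k = op_scale (q ^ k) (X ^^ k \<circ> Y)"
proof (induction k)
  case (Suc k)
  have "Y \<circ> X ^^ Suc k = (Y \<circ> X) \<circ> X ^^ k"
    by (simp only: comp_assoc funpow.simps)
  also have "\<dots> = op_scale (q ^ Suc k) (X ^^ Suc k \<circ> Y)"
    by (simp only: assms(2) op_scale_comp comp_assoc Suc comp_op_scale[OF assms(1)] op_scale_op_scale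
        funpow.simps power_Suc)
  finally show ?case .
qed simp

text \<open>This is the q-binomial theorem: \<open>E $ k * E $ (n - k)\<close> is
  \<open>E $ n\<close> times the Gaussian binomial coefficient. In the induction step a new factor
  \<open>Y\<close> passes \<open>X ^^ k\<close> at the cost \<open>q ^ k\<close>, and the q-Pascal
  rule takes the form (1 - q^k) + q^k (1 - q^(n+1-k)) = 1 - q^(n+1).\<close>

lemma q_binomial_e:
  assumes q: "norm q < 1"
    and X: "linear_oper X" and Y: "linear_oper Y" and YX: "Y \<circ> X = op_scale q (X \<circ> Y)"
  defines "E \<equiv> inverse (phi_fps q)"
  shows "E $ n * ((X + Y) ^^ n) g m = (\<Sum>k\<le>n. E $ k * E $ (n - k) * (X ^^ k \<circ> Y ^^ (n - k)) g m)"
proof (induction n arbitrary: m)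
  case 0
  show ?case by (simp add: E_def phi_fps_nth_0)
next
  case (Suc n)
  have E: "(1 - q ^ Suc k) * E $ Suc k = E $ k" for k
    using e_fps_nth_Suc[OF q] by (simp add: E_def)
  note YXk = q_commute_funpow[OF X YX]
  let ?t = "\<lambda>k l. (X ^^ k \<circ> Y ^^ l) g m"
  have "E $ n * ((X + Y) ^^ Suc n) g m = (X + Y) (\<lambda>m. E $ n * ((X + Y) ^^ n) g m) m"
    using X Y by (simp add: linear_oper_scale algebra_simps)
  also have "\<dots> = (\<Sum>k\<le>n. E $ k * E $ (n - k) * ?t (Suc k) (n - k))
      + (\<Sum>k\<le>n. E $ k * E $ (n - k) * (Y \<circ> X ^^ k \<circ> Y ^^ (n - k)) g m)"
    unfolding Suc by (simp add: linear_oper_sum[OF X] linear_oper_sum[OF Y])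
  also have "(\<Sum>k\<le>n. E $ k * E $ (n - k) * (Y \<circ> X ^^ k \<circ> Y ^^ (n - k)) g m)
      = (\<Sum>k\<le>n. q ^ k * E $ k * E $ (n - k) * ?t k (Suc n - k))"
    unfolding YXk by (intro sum.cong refl) (simp add: op_scale_def Suc_diff_le)
  \<comment> \<open>The index moves up by one; the new term at \<open>k = 0\<close> vanishes through
    the factor \<open>1 - q ^ 0\<close>.\<close>
  also have "(\<Sum>k\<le>n. E $ k * E $ (n - k) * ?t (Suc k) (n - k))
      = (\<Sum>k\<le>Suc n. (1 - q ^ k) * E $ k * E $ (Suc n - k) * ?t k (Suc n - k))"
    unfolding sum.atMost_Suc_shift[of _ n] by (simp add: E[simplified])
  \<comment> \<open>Here the range is extended at the top, where the factor \<open>1 - q ^ 0\<close>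
    makes the term at \<open>k = Suc n\<close> vanish.\<close>
  also have "(\<Sum>k\<le>n. q ^ k * E $ k * E $ (n - k) * ?t k (Suc n - k))
      = (\<Sum>k\<le>Suc n. q ^ k * (1 - q ^ (Suc n - k)) * E $ k * E $ (Suc n - k) * ?t k (Suc n - k))"
  proof -
    have "q ^ k * E $ k * E $ (n - k) * t = q ^ k * (1 - q ^ (Suc n - k)) * E $ k * E $ (Suc n - k) * t"
      if "k \<le> n" for k t
      unfolding Suc_diff_le[OF that] E[of "n - k", symmetric] by (simp only: mult_ac)
    then have "(\<Sum>k\<le>n. q ^ k * E $ k * E $ (n - k) * ?t k (Suc n - k))
        = (\<Sum>k\<le>n. q ^ k * (1 - q ^ (Suc n - k)) * E $ k * E $ (Suc n - k) * ?t k (Suc n - k))"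
      by (intro sum.cong refl) (simp only: atMost_iff)
    then show ?thesis
      by (simp only: sum.atMost_Suc diff_self_eq_0 power_0 diff_self mult_zero_left mult_zero_right
          add_0_right)
  qed
  also have "(\<Sum>k\<le>Suc n. (1 - q ^ k) * E $ k * E $ (Suc n - k) * ?t k (Suc n - k)) + \<dots>
      = (\<Sum>k\<le>Suc n. (1 - q ^ Suc n) * (E $ k * E $ (Suc n - k) * ?t k (Suc n - k)))"
    unfolding sum.distrib[symmetric]
  proof (intro sum.cong refl)
    fix k assume "k \<in> {..Suc n}"
    then have "q ^ Suc n = q ^ k * q ^ (Suc n - k)"
      by (simp flip: power_add)
    then show "(1 - q ^ k) * E $ k * E $ (Suc n - k) * ?t k (Suc n - k)
        + q ^ k * (1 - q ^ (Suc n - k)) * E $ k * E $ (Suc n - k) * ?t k (Suc n - k)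
        = (1 - q ^ Suc n) * (E $ k * E $ (Suc n - k) * ?t k (Suc n - k))"
      by (simp only: left_diff_distrib right_diff_distrib mult_1_left mult.assoc
          add_diff_eq diff_add_cancel)
  qed
  finally have "(1 - q ^ Suc n) * (E $ Suc n * ((X + Y) ^^ Suc n) g m)
      = (1 - q ^ Suc n) * (\<Sum>k\<le>Suc n. E $ k * E $ (Suc n - k) * ?t k (Suc n - k))"
    unfolding sum_distrib_left[symmetric] E[of n, symmetric] mult.assoc .
  moreover have "norm (q ^ Suc n) < 1"
    using q mult_left_le[of "norm q ^ n" "norm q"] by (simp add: norm_mult norm_power power_le_one)
  then have "1 - q ^ Suc n \<noteq> 0"
    by auto
  ultimately show ?case
    using mult_left_cancel by blast
qed

text \<open>The q-binomial theorem turns the series into a sum over the triangle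
  \<open>k + l < M\<close>. Passing to the square adds only terms that raise degrees by at least
  \<open>M\<close>, and the sum over the square is the truncated product of the two series.\<close>

lemma op_e_plus:
  fixes X Y :: "'n::finite oper"
  assumes q: "norm q < 1"
    and X: "linear_oper X" "raises_degree 1 X" and Y: "linear_oper Y" "raises_degree 1 Y"
    and YX: "Y \<circ> X = op_scale q (X \<circ> Y)"
  shows "op_e q (X + Y) = op_e q X \<circ> op_e q Y"
proof (intro ext)
  fix g and m :: "'n expo"
  define E where "E = inverse (phi_fps q)"
  define M where "M = Suc (degree_expo m)"
  have m: "degree_expo m < M"
    by (simp add: M_def)
  let ?t = "\<lambda>k l. E $ k * E $ l * (X ^^ k \<circ> Y ^^ l) g m"
  have zero: "?t k l = 0" if "k + l \<ge> M" for k l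
    using raises_degreeD[OF raises_degree_comp[OF raises_degree_funpow[OF X(2), of k]
          raises_degree_funpow[OF Y(2), of l]], of m g] m that by simp
  have "op_e q (X + Y) g m = (\<Sum>n<M. \<Sum>k\<le>n. ?t k (n - k))"
    unfolding op_e_def op_series_eq_sum[OF raises_degree_plus[OF X(2) Y(2)] m]
      q_binomial_e[OF q X(1) Y(1) YX] E_def ..
  also have "\<dots> = (\<Sum>(k, l)\<in>{(k, l). k + l < M}. ?t k l)"
    by (rule sum.triangle_reindex[symmetric])
  also have "\<dots> = (\<Sum>(k, l)\<in>{..<M} \<times> {..<M}. ?t k l)"
  proof (rule sum.mono_neutral_left)
    show "\<forall>i\<in>{..<M} \<times> {..<M} - {(k, l). k + l < M}. (case i of (k, l) \<Rightarrow> ?t k l) = 0"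
      using zero by (force simp: not_less simp del: mult_eq_0_iff)
  qed auto
  also have "\<dots> = (\<Sum>k<M. \<Sum>l<M. ?t k l)"
    by (simp add: sum.cartesian_product)
  also have "\<dots> = (\<Sum>l<M. \<Sum>k<M. ?t k l)"
    by (rule sum.swap)
  also have "\<dots> = (\<Sum>l<M. E $ l * (op_series E X \<circ> Y ^^ l) g m)"
    by (simp add: op_series_eq_sum[OF X(2) m] sum_distrib_left mult_ac)
  also have "\<dots> = (op_series E X \<circ> op_series E Y) g m"
    by (intro comp_op_series[symmetric] linear_oper_op_series raises_degree_op_series X Y m)
  finally show "op_e q (X + Y) g m = (op_e q X \<circ> op_e q Y) g m"
    by (simp add: op_e_def E_def)
qed

text \<open>Moving \<open>Y\<close> to the right turns e(X) into e(q X), which equals e(X) (1 - X)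
  by the recursion of the coefficients.\<close>

lemma comp_op_e:
  fixes X Y :: "'n::finite oper"
  assumes q: "norm q < 1"
    and X: "linear_oper X" "raises_degree 1 X" and Y: "linear_oper Y" "raises_degree 0 Y"
    and YX: "Y \<circ> X = op_scale q (X \<circ> Y)"
  shows "Y \<circ> op_e q X = op_e q X \<circ> (Y - (X \<circ> Y))"
proof (intro ext)
  fix g and m :: "'n expo"
  define E where "E = inverse (phi_fps q)"
  note YXk = q_commute_funpow[OF X(1) YX]
  let ?M = "Suc (degree_expo m)"
  have E: "q ^ Suc k * E $ Suc k = E $ Suc k - E $ k" for k
    using e_fps_nth_Suc[OF q, of k] by (simp add: E_def algebra_simps)
  have zero: "(X ^^ ?M) (Y g) m = 0"
    using raises_degreeD[OF raises_degree_funpow[OF X(2)], of m ?M] by simp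
  have "(Y \<circ> op_e q X) g m = (\<Sum>k<?M. q ^ k * E $ k * (X ^^ k) (Y g) m)"
    unfolding op_e_def comp_op_series[OF Y X(2) lessI] YXk E_def[symmetric]
    by (simp add: op_scale_def mult_ac)
  \<comment> \<open>A vanishing term is appended so that, once \<open>k = 0\<close> is split off,
    the shifted sum has again length \<open>?M\<close>.\<close>
  also have "\<dots> = (\<Sum>k<Suc ?M. q ^ k * E $ k * (X ^^ k) (Y g) m)"
    using zero by simp
  also have "\<dots> = E $ 0 * Y g m + (\<Sum>k<?M. q ^ Suc k * E $ Suc k * (X ^^ Suc k) (Y g) m)"
    by (subst sum.lessThan_Suc_shift) simp
  also have "\<dots> = E $ 0 * Y g m + (\<Sum>k<?M. E $ Suc k * (X ^^ Suc k) (Y g) m)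
      - (\<Sum>k<?M. E $ k * (X ^^ Suc k) (Y g) m)"
    unfolding E by (simp only: left_diff_distrib sum_subtractf add_diff_eq)
  also have "E $ 0 * Y g m + (\<Sum>k<?M. E $ Suc k * (X ^^ Suc k) (Y g) m)
      = (\<Sum>k<Suc ?M. E $ k * (X ^^ k) (Y g) m)"
    by (subst (2) sum.lessThan_Suc_shift) simp
  also have "\<dots> = op_series E X (Y g) m"
    unfolding op_series_eq_sum[OF X(2) lessI] using zero by simp
  also have "(\<Sum>k<?M. E $ k * (X ^^ Suc k) (Y g) m) = op_series E X (X (Y g)) m"
    unfolding op_series_eq_sum[OF X(2) lessI] by (simp only: funpow_Suc_right comp_apply)
  finally show "(Y \<circ> op_e q X) g m = (op_e q X \<circ> (Y - (X \<circ> Y))) g m"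
    using linear_oper_diff[OF linear_oper_op_series[OF X(2,1)]]
    by (simp add: op_e_def E_def)
qed

text \<open>By \<open>comp_op_e\<close>, e(X) intertwines Y - X Y with Y, and therefore also the
  exponentials of these operators. The summands - X Y and Y q-commute in their turn, so the
  exponential of Y - X Y factors.\<close>

lemma pentagon_identity:
  assumes q: "norm q < 1"
    and X: "linear_oper X" "raises_degree 1 X" and Y: "linear_oper Y" "raises_degree 1 Y"
    and YX: "Y \<circ> X = op_scale q (X \<circ> Y)"
  shows "op_e q Y \<circ> op_e q X = op_e q X \<circ> (op_e q (op_scale (-1) (X \<circ> Y)) \<circ> op_e q Y)"
proof -
  have Y0: "raises_degree 0 Y" and X0: "raises_degree 0 X"
    using raises_degree_mono[OF Y(2)] raises_degree_mono[OF X(2)] by simp_all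
  have XY: "linear_oper (op_scale (-1) (X \<circ> Y))" "raises_degree 1 (op_scale (-1) (X \<circ> Y))"
    using raises_degree_comp[OF X(2) Y0]
    by (simp_all add: X Y linear_oper_op_scale linear_oper_comp raises_degree_op_scale)
  have sum: "op_scale (-1) (X \<circ> Y) + Y = Y - (X \<circ> Y)"
    by (simp add: op_scale_def fun_eq_iff)
  have "Y \<circ> op_scale (-1) (X \<circ> Y) = op_scale (-1) (Y \<circ> X \<circ> Y)"
    by (simp add: comp_op_scale[OF Y(1)] comp_assoc)
  also have "\<dots> = op_scale q (op_scale (-1) (X \<circ> Y) \<circ> Y)"
    by (simp add: YX op_scale_comp)
  finally have "op_e q (Y - (X \<circ> Y)) = op_e q (op_scale (-1) (X \<circ> Y)) \<circ> op_e q Y"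
    unfolding sum[symmetric] by (intro op_e_plus q XY Y)
  moreover have "op_e q X \<circ> op_e q (Y - (X \<circ> Y)) = op_e q Y \<circ> op_e q X"
    unfolding op_e_def sum[symmetric]
  proof (intro op_series_intertwine linear_oper_op_series raises_degree_op_series raises_degree_plus X Y XY)
    show "op_series (inverse (phi_fps q)) X \<circ> (op_scale (- 1) (X \<circ> Y) + Y)
        = Y \<circ> op_series (inverse (phi_fps q)) X"
      using comp_op_e[OF q X Y(1) Y0 YX] unfolding sum op_e_def by simp
  qed
  ultimately show ?thesis
    by simp
qed

section \<open>Rotation of products of quantum exponentials\<close>

context monoid_list
begin

lemma F_commute: "(\<And>x. x \<in> set xs \<Longrightarrow> y \<^bold>* x = x \<^bold>* y) \<Longrightarrow> y \<^bold>* F xs = F xs \<^bold>* y"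
proof (induction xs)
  case (Cons x xs)
  have "y \<^bold>* F (x # xs) = (y \<^bold>* x) \<^bold>* F xs"
    by (simp add: assoc)
  also have "\<dots> = x \<^bold>* (y \<^bold>* F xs)"
    using Cons.prems by (simp add: assoc)
  finally show ?case
    using Cons by (simp add: assoc)
qed simp

text \<open>In the application \<open>E a b\<close> is the exponential of minus the product of the generators at the
  consecutive positions \<open>a, \<dots>, b - 1\<close> of a cycle of length \<open>N\<close>, and \<open>pentagon\<close> holds as long as the
  two windows do not exhaust the cycle. The single generator at position 0 is moved to the
  left, which prepends position 0 to all windows that start at position 1.\<close>

lemma rotate_windows:
  fixes E :: "nat \<Rightarrow> nat \<Rightarrow> 'a"
  assumes "2 \<le> N"
    and pentagon: "\<And>a b c. a < b \<Longrightarrow> b < c \<Longrightarrow> c \<le> N \<Longrightarrow> \<not> (a = 0 \<and> c = N) \<Longrightarrow>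
      E b c \<^bold>* E a b = E a b \<^bold>* (E a c \<^bold>* E b c)"
    and comm_complement: "E 0 1 \<^bold>* E 1 N = E 1 N \<^bold>* E 0 1"
    and comm_nested: "\<And>b c. 1 < b \<Longrightarrow> b < c \<Longrightarrow> c < N \<Longrightarrow> E 1 b \<^bold>* E 0 c = E 0 c \<^bold>* E 1 b"
    and comm_apart: "\<And>b p. 1 < b \<Longrightarrow> b < p \<Longrightarrow> p < N \<Longrightarrow>
      E p (Suc p) \<^bold>* E 1 b = E 1 b \<^bold>* E p (Suc p)"
  shows "F (map (\<lambda>k. E 1 (k + 2)) [0..<N - 1]) \<^bold>* (E 0 1 \<^bold>* F (map (\<lambda>p. E p (Suc p)) (rev [2..<N])))
    = F (map (\<lambda>k. E 0 (k + 1)) [0..<N - 1]) \<^bold>* F (map (\<lambda>p. E p (Suc p)) (rev [1..<N]))"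
proof -
  \<comment> \<open>\<open>A\<close> and \<open>C\<close>, with \<open>E 0 1\<close> between them,
    build the left side, and \<open>B\<close> and \<open>D\<close> the right side. The truncations
    at \<open>n\<close> are what the inductions run over.\<close>
  define A where "A n = F (map (\<lambda>k. E 1 (k + 2)) [0..<n])" for n
  define B where "B n = F (map (\<lambda>k. E 0 (k + 1)) [0..<n])" for n
  define C where "C n = F (map (\<lambda>p. E p (Suc p)) (rev [2..<Suc n]))" for n
  define D where "D n = F (map (\<lambda>p. E p (Suc p)) (rev [1..<Suc n]))" for n
  have A_Suc: "A (Suc n) = A n \<^bold>* E 1 (n + 2)" for n
    by (simp add: A_def)
  have B_Suc: "B (Suc n) = B n \<^bold>* E 0 (Suc n)" for n
    by (simp add: B_def)
  \<comment> \<open>Moving \<open>E 0 1\<close> past \<open>E 1 (n + 2)\<close> creates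
    \<open>E 0 (n + 2)\<close>, which commutes with the shorter windows nested in it and so joins
    \<open>B\<close>. The bound on \<open>n\<close> keeps out the window complementary to position
    0.\<close>
  have prepend: "A n \<^bold>* E 0 1 = B (Suc n) \<^bold>* A n" if "n + 2 \<le> N" for n
    using that
  proof (induction n)
    case 0
    show ?case by (simp add: A_def B_def)
  next
    case (Suc n)
    have comm: "A n \<^bold>* E 0 (n + 2) = E 0 (n + 2) \<^bold>* A n"
      unfolding A_def by (rule F_commute[symmetric]) (use Suc.prems in \<open>auto intro!: comm_nested[symmetric, simplified]\<close>)
    have "A (Suc n) \<^bold>* E 0 1 = A n \<^bold>* (E 0 1 \<^bold>* (E 0 (n + 2) \<^bold>* E 1 (n + 2)))"
      unfolding A_Suc assoc using Suc.prems by (subst pentagon) auto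
    also have "\<dots> = (A n \<^bold>* E 0 1) \<^bold>* (E 0 (n + 2) \<^bold>* E 1 (n + 2))"
      by (simp only: assoc)
    also have "\<dots> = B (Suc n) \<^bold>* ((A n \<^bold>* E 0 (n + 2)) \<^bold>* E 1 (n + 2))"
      using Suc by (simp add: assoc)
    also have "\<dots> = B (Suc (Suc n)) \<^bold>* A (Suc n)"
      unfolding comm by (simp add: assoc A_Suc B_Suc)
    finally show ?case .
  qed
  \<comment> \<open>The pentagon identity is read from right to left: \<open>E 1 (Suc n)\<close>,
    \<open>E 1 (Suc (Suc n))\<close> and \<open>?e\<close> contract to \<open>?e\<close> followed by
    \<open>E 1 (Suc n)\<close>, and \<open>?e\<close> then moves to the front past the windows that
    do not touch it.\<close>
  have merge: "A n \<^bold>* C n = D n" if "n < N" for n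
    using that
  proof (induction n)
    case 0
    show ?case by (simp add: A_def C_def D_def)
  next
    case (Suc n)
    show ?case
    proof (cases n)
      case 0
      then show ?thesis by (simp add: A_def C_def D_def numeral_2_eq_2)
    next
      case n: (Suc l)
      let ?e = "E (Suc n) (Suc (Suc n))"
      have comm: "?e \<^bold>* A l = A l \<^bold>* ?e"
        unfolding A_def
      proof (rule F_commute)
        fix x assume "x \<in> set (map (\<lambda>k. E 1 (k + 2)) [0..<l])"
        then obtain k where "x = E 1 (k + 2)" "k < l"
          by auto
        then show "?e \<^bold>* x = x \<^bold>* ?e"
          using Suc.prems n comm_apart[of "k + 2" "Suc n"] by simp
      qed
      have A_n: "A n = A l \<^bold>* E 1 (Suc n)"
        by (simp add: A_Suc n)
      have C: "C (Suc n) = ?e \<^bold>* C n" and D: "D (Suc n) = ?e \<^bold>* D n"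
        using n by (simp_all add: C_def D_def)
      have "A (Suc n) \<^bold>* C (Suc n) = A l \<^bold>* ((E 1 (Suc n) \<^bold>* (E 1 (Suc (Suc n)) \<^bold>* ?e)) \<^bold>* C n)"
        by (simp add: A_Suc A_n C assoc)
      also have "E 1 (Suc n) \<^bold>* (E 1 (Suc (Suc n)) \<^bold>* ?e) = ?e \<^bold>* E 1 (Suc n)"
        using Suc.prems n by (subst pentagon) auto
      also have "A l \<^bold>* ((?e \<^bold>* E 1 (Suc n)) \<^bold>* C n) = (A l \<^bold>* ?e) \<^bold>* (E 1 (Suc n) \<^bold>* C n)"
        by (simp only: assoc)
      also have "\<dots> = ?e \<^bold>* (A n \<^bold>* C n)"
        unfolding comm[symmetric] A_n by (simp only: assoc)
      also have "\<dots> = D (Suc n)"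
        using Suc by (simp add: D)
      finally show ?thesis .
    qed
  qed
  from \<open>2 \<le> N\<close> obtain M where N: "N = Suc (Suc M)"
    by (metis One_nat_def Suc_1 Suc_le_D Suc_le_mono)
  have "A (Suc M) \<^bold>* E 0 1 = A M \<^bold>* (E 1 N \<^bold>* E 0 1)"
    by (simp add: A_Suc N assoc)
  also have "\<dots> = (A M \<^bold>* E 0 1) \<^bold>* E 1 N"
    unfolding comm_complement[symmetric] by (simp only: assoc)
  also have "\<dots> = B (Suc M) \<^bold>* A (Suc M)"
    using prepend[of M] by (simp add: N A_Suc assoc)
  finally have "A (Suc M) \<^bold>* (E 0 1 \<^bold>* C (Suc M)) = B (Suc M) \<^bold>* D (Suc M)"
    using merge[of "Suc M"] by (simp add: N assoc flip: assoc[of "A (Suc M)"])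
  then show ?thesis
    by (simp add: A_def B_def C_def D_def N)
qed

end

section \<open>Products in the monoid of operators and in its opposite\<close>

lemma monoid_list_comp: "monoid_list (\<circ>) id"
  by unfold_locales (simp_all add: comp_assoc)

lemma monoid_list_comp_F: "monoid_list.F (\<circ>) id = op_prod"
  by (simp add: fun_eq_iff op_prod_def monoid_list.eq_foldr[OF monoid_list_comp])

lemma op_prod_Nil [simp]: "op_prod [] = id"
  and op_prod_Cons [simp]: "op_prod (T # Ts) = T \<circ> op_prod Ts"
  by (simp_all add: op_prod_def)

lemma op_prod_append: "op_prod (Ss @ Ts) = op_prod Ss \<circ> op_prod Ts"
  by (induction Ss) (simp_all add: comp_assoc)

text \<open>In this opposite monoid \<open>rotate_windows\<close> yields the rotation of the product
  underlying \<open>A_R\<close>.\<close>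

lemma monoid_list_flip_comp: "monoid_list (\<lambda>S T. T \<circ> S) id"
  by unfold_locales (simp_all add: comp_assoc)

lemma monoid_list_flip_comp_F: "monoid_list.F (\<lambda>S T. T \<circ> S) id Ts = op_prod (rev Ts)"
  by (induction Ts)
    (simp_all only: monoid_list.Nil[OF monoid_list_flip_comp] monoid_list.Cons[OF monoid_list_flip_comp]
      rev.simps op_prod_append op_prod_Nil op_prod_Cons comp_id)

section \<open>Words in the generators and their commutation weights\<close>

lemma linear_oper_op_prod: "(\<And>T. T \<in> set Ts \<Longrightarrow> linear_oper T) \<Longrightarrow> linear_oper (op_prod Ts)"
  by (induction Ts) (simp_all add: linear_oper_comp)

lemma raises_degree_op_prod:
  assumes "\<And>T. T \<in> set Ts \<Longrightarrow> raises_degree 1 T"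
  shows "raises_degree (length Ts) (op_prod Ts)"
  using assms
proof (induction Ts)
  case (Cons T Ts)
  then have "raises_degree (1 + length Ts) (T \<circ> op_prod Ts)"
    by (intro raises_degree_comp) simp_all
  then show ?case
    by (simp only: op_prod_Cons list.size plus_1_eq_Suc add_0_right add_Suc_right)
qed (simp add: raises_degree_id)

lemma raises_degree_word:
  assumes "\<And>i. raises_degree 1 (G i)" "is \<noteq> []"
  shows "raises_degree 1 (op_prod (map G is))"
proof (rule raises_degree_mono)
  show "raises_degree (length (map G is)) (op_prod (map G is))"
    by (rule raises_degree_op_prod) (auto intro: assms(1)[unfolded One_nat_def])
qed (use assms(2) in \<open>cases "is"; simp\<close>)

text \<open>The exponent in the exchange relation is a difference of indicators and not a case
  distinction: for N = 2 both conditions can hold at once, and then they cancel.\<close>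

definition commutation_weight :: "'n::nontriv mod_ring \<Rightarrow> 'n mod_ring \<Rightarrow> int" where
  "commutation_weight i j = of_bool (i = j + 1) - of_bool (j = i + 1)"

text \<open>Weights add up as letters pass one another. The inner induction moves a single letter
  past \<open>js\<close>, the outer one moves the whole word.\<close>

lemma op_prod_commute_weight:
  assumes lin: "\<And>i. linear_oper (G i)" and "p \<noteq> 0"
    and comm: "\<And>i j. G i \<circ> G j = op_scale (p powi commutation_weight i j) (G j \<circ> G i)"
  shows "op_prod (map G is) \<circ> op_prod (map G js)
    = op_scale (p powi (\<Sum>i\<leftarrow>is. \<Sum>j\<leftarrow>js. commutation_weight i j))
        (op_prod (map G js) \<circ> op_prod (map G is))"
proof (induction "is")
  case (Cons i "is")
  have one: "G i \<circ> op_prod (map G js)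
    = op_scale (p powi (\<Sum>j\<leftarrow>js. commutation_weight i j)) (op_prod (map G js) \<circ> G i)"
  proof (induction js)
    case (Cons j js)
    have "G i \<circ> op_prod (map G (j # js)) = (G i \<circ> G j) \<circ> op_prod (map G js)"
      by (simp add: comp_assoc)
    also have "\<dots> = op_scale (p powi commutation_weight i j) (G j \<circ> (G i \<circ> op_prod (map G js)))"
      by (simp add: comm[of i j] op_scale_comp comp_assoc)
    finally show ?case
      by (simp only: Cons comp_op_scale[OF lin] op_scale_op_scale comp_assoc list.map op_prod_Cons
          sum_list.Cons power_int_add[OF disjI1[OF \<open>p \<noteq> 0\<close>]])
  qed simp
  have "op_prod (map G (i # is)) \<circ> op_prod (map G js) = G i \<circ> (op_prod (map G is) \<circ> op_prod (map G js))"
    by (simp add: comp_assoc)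
  also have "\<dots> = op_scale (p powi (\<Sum>i\<leftarrow>is. \<Sum>j\<leftarrow>js. commutation_weight i j))
      ((G i \<circ> op_prod (map G js)) \<circ> op_prod (map G is))"
    unfolding Cons by (simp add: comp_op_scale[OF lin] comp_assoc)
  finally show ?case
    by (simp only: one op_scale_comp op_scale_op_scale comp_assoc list.map op_prod_Cons sum_list.Cons
        power_int_add[OF disjI1[OF \<open>p \<noteq> 0\<close>]] mult.commute)
qed simp

section \<open>Windows of the cycle and their commutation weights\<close>

definition e_word :: "complex \<Rightarrow> ('n mod_ring \<Rightarrow> 'n oper) \<Rightarrow> 'n mod_ring list \<Rightarrow> 'n oper" where
  "e_word q G is = op_e q (op_scale (-1) (op_prod (map G is)))"

text \<open>The cycle is cut open before the index \<open>-1\<close>: position \<open>k\<close> carries the index \<open>k - 1\<close>.\<close>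

definition window :: "nat \<Rightarrow> nat \<Rightarrow> 'n::nontriv mod_ring list" where
  "window a b = map (\<lambda>k. of_nat k - 1) [a..<b]"

lemma of_nat_mod_ring_eq_plus_one_iff:
  assumes "k < CARD('n::nontriv)" "l < CARD('n)"
  shows "(of_nat k :: 'n mod_ring) = of_nat l + 1 \<longleftrightarrow> k = Suc l \<or> k = 0 \<and> Suc l = CARD('n)"
proof -
  have "(of_nat k :: 'n mod_ring) = of_nat l + 1 \<longleftrightarrow> (of_nat k :: 'n mod_ring) = of_nat (Suc l)"
    by (simp add: add.commute)
  also have "\<dots> \<longleftrightarrow> k mod CARD('n) = Suc l mod CARD('n)"
    by (simp only: of_nat_eq_iff_cong_CHAR cong_def semiring_char_mod_ring)
  also have "\<dots> \<longleftrightarrow> k = Suc l \<or> k = 0 \<and> Suc l = CARD('n)"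
    using assms by (cases "Suc l = CARD('n)") auto
  finally show ?thesis .
qed

text \<open>Only the two cyclic neighbours of position \<open>k\<close> can contribute: the
  predecessor with sign plus, the successor with sign minus. The indicators involving
  \<open>CARD('n)\<close> account for neighbours across the cut.\<close>

lemma sum_commutation_weight_window:
  assumes "k < CARD('n::nontriv)" "c < d" "d \<le> CARD('n)"
  shows "(\<Sum>j\<leftarrow>window c d. commutation_weight (of_nat k - 1 :: 'n mod_ring) j)
    = of_bool (c < k \<and> k \<le> d) + of_bool (k = 0 \<and> d = CARD('n))
      - of_bool (c \<le> Suc k \<and> Suc k < d) - of_bool (Suc k = CARD('n) \<and> c = 0)"
proof -
  have of_bool_delta: "(\<Sum>l\<in>{c..<d}. of_bool (l = m \<and> P)) = (of_bool (m \<in> {c..<d} \<and> P) :: int)" for m P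
    by (cases P) (simp_all add: of_bool_def)
  have "(\<Sum>j\<leftarrow>window c d. commutation_weight (of_nat k - 1 :: 'n mod_ring) j)
      = (\<Sum>l\<in>{c..<d}. commutation_weight (of_nat k - 1 :: 'n mod_ring) (of_nat l - 1))"
    by (simp add: window_def interv_sum_list_conv_sum_set_nat comp_def)
  \<comment> \<open>Every indicator is brought to the shape \<open>l = m \<and> P\<close>, with
    \<open>True\<close> where there is no side condition, so that \<open>of_bool_delta\<close>
    evaluates all four.\<close>
  also have "\<dots> = (\<Sum>l\<in>{c..<d}. of_bool (l = k - 1 \<and> 0 < k) + of_bool (l = CARD('n) - 1 \<and> k = 0)
      - of_bool (l = Suc k \<and> True) - of_bool (l = 0 \<and> Suc k = CARD('n)))"
  proof (intro sum.cong refl)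
    fix l assume "l \<in> {c..<d}"
    then have l: "l < CARD('n)" using assms by simp
    have "of_bool ((of_nat k - 1 :: 'n mod_ring) = of_nat l - 1 + 1)
        = (of_bool (l = k - 1 \<and> 0 < k) + of_bool (l = CARD('n) - 1 \<and> k = 0) :: int)"
      using of_nat_mod_ring_eq_plus_one_iff[OF assms(1) l] by (auto simp: diff_eq_eq)
    moreover have "of_bool ((of_nat l - 1 :: 'n mod_ring) = of_nat k - 1 + 1)
        = (of_bool (l = Suc k \<and> True) + of_bool (l = 0 \<and> Suc k = CARD('n)) :: int)"
      using of_nat_mod_ring_eq_plus_one_iff[OF l assms(1)] by (auto simp: diff_eq_eq)
    ultimately show "commutation_weight (of_nat k - 1 :: 'n mod_ring) (of_nat l - 1)
        = of_bool (l = k - 1 \<and> 0 < k) + of_bool (l = CARD('n) - 1 \<and> k = 0)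
        - of_bool (l = Suc k \<and> True) - of_bool (l = 0 \<and> Suc k = CARD('n))"
      unfolding commutation_weight_def by simp
  qed
  also have "\<dots> = of_bool (k - 1 \<in> {c..<d} \<and> 0 < k) + of_bool (CARD('n) - 1 \<in> {c..<d} \<and> k = 0)
      - of_bool (Suc k \<in> {c..<d} \<and> True) - of_bool (0 \<in> {c..<d} \<and> Suc k = CARD('n))"
    by (simp only: sum.distrib sum_subtractf of_bool_delta)
  also have "\<dots> = of_bool (c < k \<and> k \<le> d) + of_bool (k = 0 \<and> d = CARD('n))
      - of_bool (c \<le> Suc k \<and> Suc k < d) - of_bool (Suc k = CARD('n) \<and> c = 0)"
    using assms by (intro arg_cong2[of _ _ _ _ "(-)"] arg_cong2[of _ _ _ _ "(+)"] arg_cong[of _ _ of_bool]) auto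
  finally show ?thesis .
qed

abbreviation window_weight :: "'n::nontriv itself \<Rightarrow> nat \<Rightarrow> nat \<Rightarrow> nat \<Rightarrow> nat \<Rightarrow> int" where
  "window_weight TYPE('n) a b c d \<equiv>
     (\<Sum>i\<leftarrow>(window a b :: 'n mod_ring list). \<Sum>j\<leftarrow>window c d. commutation_weight i j)"

lemma window_weight_eq:
  assumes "b \<le> CARD('n::nontriv)" "c < d" "d \<le> CARD('n)"
  shows "window_weight TYPE('n) a b c d
    = (\<Sum>k\<in>{a..<b}. of_bool (c < k \<and> k \<le> d) + of_bool (k = 0 \<and> d = CARD('n))
      - of_bool (c \<le> Suc k \<and> Suc k < d) - of_bool (Suc k = CARD('n) \<and> c = 0))"
proof -
  have "window_weight TYPE('n) a b c d
      = (\<Sum>k\<in>{a..<b}. \<Sum>j\<leftarrow>window c d. commutation_weight (of_nat k - 1 :: 'n mod_ring) j)"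
    by (subst window_def) (simp add: interv_sum_list_conv_sum_set_nat comp_def)
  also have "\<dots> = (\<Sum>k\<in>{a..<b}. of_bool (c < k \<and> k \<le> d) + of_bool (k = 0 \<and> d = CARD('n))
      - of_bool (c \<le> Suc k \<and> Suc k < d) - of_bool (Suc k = CARD('n) \<and> c = 0))"
    using assms by (intro sum.cong refl sum_commutation_weight_window) auto
  finally show ?thesis .
qed

text \<open>The only contact is between positions \<open>b - 1\<close> and \<open>b\<close>; a
  second one across the cut would require \<open>a = 0\<close> and
  \<open>c = CARD('n)\<close>.\<close>

lemma window_weight_adjacent:
  assumes "a < b" "b < c" "c \<le> CARD('n::nontriv)" "\<not> (a = 0 \<and> c = CARD('n))"
  shows "window_weight TYPE('n) b c a b = 1"
proof -
  have "window_weight TYPE('n) b c a b = (\<Sum>k\<in>{b..<c}. if k = b then 1 else 0)"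
    unfolding window_weight_eq[OF assms(3,1) order.trans[OF less_imp_le[OF assms(2)] assms(3)]]
    using assms by (intro sum.cong refl) auto
  with assms show ?thesis by simp
qed

text \<open>Position 0 touches its complement on both sides, with opposite signs.\<close>

lemma window_weight_complement:
  "window_weight TYPE('n::nontriv) 0 1 1 (CARD('n)) = 0"
  using nontriv[where ?'a = 'n] by (subst window_weight_eq) auto

text \<open>Both neighbours of each inner position lie in the outer window, so their contributions
  cancel.\<close>

lemma window_weight_nested:
  assumes "1 < b" "b < c" "c < CARD('n::nontriv)"
  shows "window_weight TYPE('n) 1 b 0 c = 0"
  using assms by (subst window_weight_eq) auto

text \<open>The gap keeps \<open>k\<close> away from the upper end of the window; position 0 is not
  in the window, so there is no contact across the cut either.\<close>

lemma window_weight_apart: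
  assumes "1 < b" "b < k" "k < CARD('n::nontriv)"
  shows "window_weight TYPE('n) k (Suc k) 1 b = 0"
  using assms by (subst window_weight_eq) auto

lemma commutation_weight_commute: "commutation_weight i j = - commutation_weight j i"
  by (simp add: commutation_weight_def)

lemma sum_commutation_weight_commute:
  "(\<Sum>i\<leftarrow>is. \<Sum>j\<leftarrow>js. commutation_weight i j) = - (\<Sum>j\<leftarrow>js. \<Sum>i\<leftarrow>is. commutation_weight j i)"
proof (induction "is")
  case (Cons i "is")
  have "(\<Sum>j\<leftarrow>js. commutation_weight i j) = - (\<Sum>j\<leftarrow>js. commutation_weight j i)"
    by (induction js) (simp_all add: commutation_weight_commute[of i])
  with Cons show ?case
    by (simp add: sum_list_addf)
qed simp

lemma sum_list_rev_rev:
  fixes f :: "'a \<Rightarrow> 'b \<Rightarrow> int"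
  shows "(\<Sum>i\<leftarrow>rev is. \<Sum>j\<leftarrow>rev js. f i j) = (\<Sum>i\<leftarrow>is. \<Sum>j\<leftarrow>js. f i j)"
  by (simp add: rev_map[symmetric] sum_list_rev)

text \<open>The base \<open>q\<close> of the exponentials and the base \<open>p\<close> of the
  exchange relation are kept apart because the hatted generators have
  \<open>p = inverse q\<close>.\<close>

locale cyclic_generators =
  fixes q p :: complex and G :: "'n::nontriv mod_ring \<Rightarrow> 'n oper"
  assumes norm_q: "norm q < 1" and p_nonzero: "p \<noteq> 0"
    and linear: "linear_oper (G i)" and raises: "raises_degree 1 (G i)"
    and comm: "G i \<circ> G j = op_scale (p powi commutation_weight i j) (G j \<circ> G i)"
begin

lemma linear_word: "linear_oper (op_prod (map G is))"
  by (rule linear_oper_op_prod) (auto simp: linear)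

lemma raises_word: "is \<noteq> [] \<Longrightarrow> raises_degree 1 (op_prod (map G is))"
  using raises by (rule raises_degree_word)

lemma e_word_commute:
  assumes "is \<noteq> []" "js \<noteq> []" "(\<Sum>i\<leftarrow>is. \<Sum>j\<leftarrow>js. commutation_weight i j) = 0"
  shows "e_word q G is \<circ> e_word q G js = e_word q G js \<circ> e_word q G is"
  unfolding e_word_def op_e_def
proof (intro op_series_commute)
  show "op_scale (-1) (op_prod (map G is)) \<circ> op_scale (-1) (op_prod (map G js))
      = op_scale (-1) (op_prod (map G js)) \<circ> op_scale (-1) (op_prod (map G is))"
    using op_prod_commute_weight[OF linear p_nonzero comm, of "is" js] assms(3)
    by (simp add: op_scale_comp comp_op_scale[OF linear_word])
qed (use assms in \<open>auto intro!: raises_degree_op_scale linear_oper_op_scale raises_word[unfolded One_nat_def] linear_word\<close>)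

text \<open>Since both arguments carry the factor -1, the middle argument of the pentagon identity
  is again minus a word, namely the concatenation.\<close>

lemma e_word_pentagon:
  assumes "is \<noteq> []" "js \<noteq> []" "p powi (\<Sum>j\<leftarrow>js. \<Sum>i\<leftarrow>is. commutation_weight j i) = q"
  shows "e_word q G js \<circ> e_word q G is = e_word q G is \<circ> (e_word q G (is @ js) \<circ> e_word q G js)"
proof -
  let ?X = "op_scale (-1) (op_prod (map G is))" and ?Y = "op_scale (-1) (op_prod (map G js))"
  have "op_e q ?Y \<circ> op_e q ?X = op_e q ?X \<circ> (op_e q (op_scale (-1) (?X \<circ> ?Y)) \<circ> op_e q ?Y)"
  proof (rule pentagon_identity)
    show "?Y \<circ> ?X = op_scale q (?X \<circ> ?Y)"
      using op_prod_commute_weight[OF linear p_nonzero comm, of js "is"] assms(3)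
      by (simp add: op_scale_comp comp_op_scale[OF linear_word])
  qed (intro norm_q linear_oper_op_scale raises_degree_op_scale linear_word raises_word assms)+
  moreover have "?X \<circ> ?Y = op_prod (map G (is @ js))"
    by (simp add: op_scale_comp comp_op_scale[OF linear_word] op_prod_append)
  ultimately show ?thesis
    by (simp add: e_word_def)
qed

end

section \<open>Cyclic rotation of the two ordered products\<close>

lemma window_nonempty: "a < b \<Longrightarrow> window a b \<noteq> []"
  by (simp add: window_def)

lemma window_append: "a \<le> b \<Longrightarrow> b \<le> c \<Longrightarrow> window a b @ window b c = window a c"
  unfolding window_def map_append[symmetric] using upt_add_eq_append[of a b "c - b"] by simp

lemma window_1: "window 1 (k + 2) = map of_nat [0..<k + 1]"
  by (simp add: window_def map_Suc_upt[symmetric] comp_def del: upt_Suc)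

lemma e_word_window_0: "e_word q G (window 0 1) = e_word q G [of_nat (CARD('n::nontriv) - 1) :: 'n mod_ring]"
  using nontriv[where ?'a = 'n] by (simp add: window_def of_nat_diff)

text \<open>The factor of index N - 1 is set apart, since that index sits at position 0 while every
  other index \<open>i\<close> sits at position \<open>i + 1\<close>.\<close>

lemma rev_window_tail:
  fixes f :: "'n::nontriv mod_ring \<Rightarrow> 'a"
  shows "map (\<lambda>k. f (of_nat k)) (rev [1..<CARD('n)])
    = f (of_nat (CARD('n) - 1)) # map (\<lambda>k. f (of_nat k - 1)) (rev [2..<CARD('n)])"
proof -
  obtain M where M: "CARD('n) = Suc (Suc M)"
    using nontriv[where ?'a = 'n] by (metis One_nat_def less_natE plus_1_eq_Suc add_Suc)
  have "rev [2..<CARD('n)] = map Suc (rev [1..<Suc M])"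
    by (simp only: M numeral_2_eq_2 One_nat_def map_Suc_upt[symmetric] rev_map)
  then show ?thesis
    by (simp add: M comp_def)
qed

text \<open>This is \<open>A_L\<close> without its central factor, for arbitrary generators, so that
  a rotation becomes a substitution of generators.\<close>

definition product_L :: "complex \<Rightarrow> ('n::nontriv mod_ring \<Rightarrow> 'n oper) \<Rightarrow> 'n oper" where
  "product_L q G =
     op_prod (map (\<lambda>k. e_word q G (map of_nat [0..<k + 1])) [0..<CARD('n) - 1])
     \<circ> op_prod (map (\<lambda>k. e_word q G [of_nat k]) (rev [1..<CARD('n)]))"

definition product_R :: "complex \<Rightarrow> ('n::nontriv mod_ring \<Rightarrow> 'n oper) \<Rightarrow> 'n oper" where
  "product_R q G =
     op_prod (map (\<lambda>k. e_word q G [of_nat k]) [1..<CARD('n)])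
     \<circ> op_prod (map (\<lambda>k. e_word q G (rev (map of_nat [0..<k + 1]))) (rev [0..<CARD('n) - 1]))"

lemma e_word_shift: "e_word q (\<lambda>i. G (i - 1)) is = e_word q G (map (\<lambda>i. i - 1) is)"
  by (simp add: e_word_def comp_def)

text \<open>In terms of positions, the words of \<open>product_L q G\<close> start at position 1,
  while replacing \<open>G i\<close> by \<open>G (i - 1)\<close> makes them start at position 0.
  These are the two sides of \<open>rotate_windows\<close>.\<close>

lemma product_L_rotate:
  assumes "cyclic_generators q q G"
  shows "product_L q (\<lambda>i. G (i - 1)) = product_L q (G :: 'n::nontriv mod_ring \<Rightarrow> 'n oper)"
proof -
  interpret cyclic_generators q q G by fact
  let ?N = "CARD('n)"
  have N: "2 \<le> ?N"
    using nontriv[where ?'a = 'n] by simp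
  define E where "E a b = e_word q G (window a b)" for a b
  have "op_prod (map (\<lambda>k. E 1 (k + 2)) [0..<?N - 1]) \<circ> (E 0 1 \<circ> op_prod (map (\<lambda>p. E p (Suc p)) (rev [2..<?N])))
    = op_prod (map (\<lambda>k. E 0 (k + 1)) [0..<?N - 1]) \<circ> op_prod (map (\<lambda>p. E p (Suc p)) (rev [1..<?N]))"
  proof (rule monoid_list.rotate_windows[OF monoid_list_comp N, where E = E, unfolded monoid_list_comp_F])
    fix a b c :: nat
    assume abc: "a < b" "b < c" "c \<le> ?N" "\<not> (a = 0 \<and> c = ?N)"
    show "E b c \<circ> E a b = E a b \<circ> (E a c \<circ> E b c)"
      unfolding E_def using abc e_word_pentagon[of "window a b" "window b c"]
      by (simp add: window_weight_adjacent window_nonempty window_append)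
  qed (use N in \<open>auto simp: E_def window_nonempty window_weight_complement[unfolded One_nat_def]
      window_weight_nested[unfolded One_nat_def] window_weight_apart[unfolded One_nat_def] intro!: e_word_commute\<close>)
  moreover have "E 0 1 \<circ> op_prod (map (\<lambda>p. E p (Suc p)) (rev [2..<?N]))
      = op_prod (map (\<lambda>k. e_word q G [of_nat k]) (rev [1..<?N]))"
    unfolding rev_window_tail[of "\<lambda>i. e_word q G [i]"]
    unfolding E_def e_word_window_0 by (simp add: window_def)
  moreover have "E 1 (k + 2) = e_word q G (map of_nat [0..<k + 1])"
    "E 0 (k + 1) = e_word q (\<lambda>i. G (i - 1)) (map of_nat [0..<k + 1])"
    "E k (Suc k) = e_word q (\<lambda>i. G (i - 1)) [of_nat k]" for k
    by (simp_all only: E_def window_1 e_word_shift) (simp_all add: window_def comp_def)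
  ultimately show ?thesis
    by (simp only: product_L_def)
qed

text \<open>Words and factors both appear in reversed order, so the argument for
  \<open>product_L\<close> runs in the opposite monoid with reversed windows.\<close>

lemma product_R_rotate:
  assumes "cyclic_generators q (inverse q) G"
  shows "product_R q (\<lambda>i. G (i - 1)) = product_R q (G :: 'n::nontriv mod_ring \<Rightarrow> 'n oper)"
proof -
  interpret cyclic_generators q "inverse q" G by fact
  let ?N = "CARD('n)"
  have N: "2 \<le> ?N"
    using nontriv[where ?'a = 'n] by simp
  define E where "E a b = e_word q G (rev (window a b))" for a b
  have "op_prod (map (\<lambda>p. E p (Suc p)) [2..<?N]) \<circ> E 0 1 \<circ> op_prod (map (\<lambda>k. E 1 (k + 2)) (rev [0..<?N - 1]))
    = op_prod (map (\<lambda>p. E p (Suc p)) [1..<?N]) \<circ> op_prod (map (\<lambda>k. E 0 (k + 1)) (rev [0..<?N - 1]))"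
  proof (rule monoid_list.rotate_windows[OF monoid_list_flip_comp N, where E = E,
        unfolded monoid_list_flip_comp_F rev_map rev_rev_ident])
    fix a b c :: nat
    assume abc: "a < b" "b < c" "c \<le> ?N" "\<not> (a = 0 \<and> c = ?N)"
    \<comment> \<open>Exchanging the two windows gives weight -1, which the base
      \<open>inverse q\<close> turns back into \<open>q\<close>.\<close>
    have "inverse q powi window_weight TYPE('n) a b b c = q"
      using window_weight_adjacent[OF abc] by (subst sum_commutation_weight_commute) (simp add: power_int_minus)
    then show "E a b \<circ> E b c = E b c \<circ> E a c \<circ> E a b"
      unfolding E_def using abc e_word_pentagon[of "rev (window b c)" "rev (window a b)"]
      by (simp add: sum_list_rev_rev window_nonempty window_append comp_assoc flip: rev_append)
  qed (use N in \<open>auto simp: E_def window_nonempty window_weight_complement[unfolded One_nat_def] sum_list_rev_rev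
      window_weight_nested[unfolded One_nat_def] window_weight_apart[unfolded One_nat_def] intro!: e_word_commute[symmetric]\<close>)
  moreover have "op_prod (map (\<lambda>p. E p (Suc p)) [2..<?N]) \<circ> E 0 1
      = op_prod (map (\<lambda>k. e_word q G [of_nat k]) [1..<?N])"
    using arg_cong[OF rev_window_tail[of "\<lambda>i. e_word q G [i]"], of rev]
      e_word_window_0[where ?'n = 'n, of q G]
    by (simp add: rev_map op_prod_append E_def window_def)
  moreover have "E 1 (k + 2) = e_word q G (rev (map of_nat [0..<k + 1]))"
    "E 0 (k + 1) = e_word q (\<lambda>i. G (i - 1)) (rev (map of_nat [0..<k + 1]))"
    "E k (Suc k) = e_word q (\<lambda>i. G (i - 1)) [of_nat k]" for k
    by (simp_all only: E_def window_1 e_word_shift) (simp_all add: window_def comp_def rev_map)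
  ultimately show ?thesis
    by (simp only: product_R_def)
qed

section \<open>The generators\<close>

lemma mod_ring_minus_one_neq: "(i :: 'n::nontriv mod_ring) \<noteq> i - 1"
  by (auto simp: algebra_simps)

text \<open>The diagonal factor is evaluated at the exponent vector already lowered at
  \<open>i\<close>, hence the \<open>+ 1\<close>; the exponent at \<open>i - 1\<close> is untouched
  because \<open>i - 1\<close> differs from \<open>i\<close>.\<close>

lemma x_check_apply:
  "x_check p i g m = (if m i = 0 then 0
     else p powi (int (m (i - 1)) + 1 - int (m i)) * g (m(i := m i - 1)))"
  by (simp add: x_check_def op_var_def op_diag_def mod_ring_minus_one_neq of_nat_diff algebra_simps)

lemma degree_expo_decrement: "m i \<noteq> 0 \<Longrightarrow> degree_expo m = Suc (degree_expo (m(i := m i - 1)))"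
proof -
  assume "m i \<noteq> 0"
  have "degree_expo m = m i + (\<Sum>j\<in>UNIV - {i}. m j)"
    unfolding degree_expo_def by (rule sum.remove) simp_all
  moreover have "degree_expo (m(i := m i - 1)) = m i - 1 + (\<Sum>j\<in>UNIV - {i}. m j)"
    unfolding degree_expo_def by (subst sum.remove[of _ i]) (auto intro!: sum.cong)
  ultimately show ?thesis
    using \<open>m i \<noteq> 0\<close> by simp
qed

lemma linear_oper_x_check: "linear_oper (x_check p i)"
  by (auto simp: linear_oper_def fun_eq_iff x_check_apply algebra_simps)

lemma raises_degree_x_check: "raises_degree 1 (x_check p i)" for i :: "'n::nontriv mod_ring"
  unfolding raises_degree_def
proof (intro allI impI)
  fix k and g :: "'n pser" and m :: "'n expo"
  assume g: "\<forall>m. degree_expo m < k \<longrightarrow> g m = 0" and "degree_expo m < k + 1"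
  then have "m i \<noteq> 0 \<Longrightarrow> g (m(i := m i - 1)) = 0"
    using degree_expo_decrement[of m i] by simp
  then show "x_check p i g m = 0"
    by (simp add: x_check_apply)
qed

text \<open>One generator lowers an exponent read by the power of \<open>p\<close> in a different
  generator exactly when the indices are neighbours. The two orders of composition therefore differ
  by the commutation weight.\<close>

lemma x_check_commute:
  assumes "p \<noteq> 0"
  shows "x_check p i \<circ> x_check p j = op_scale (p powi commutation_weight i j) (x_check p j \<circ> x_check p i)"
proof (cases "i = j")
  case True
  then show ?thesis
    by (simp add: commutation_weight_def)
next
  case False
  have ij: "i = j + 1 \<longleftrightarrow> i - 1 = j" and ji: "j = i + 1 \<longleftrightarrow> j - 1 = i"
    by (auto simp: algebra_simps)
  show ?thesis
  proof (intro ext)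
    fix g :: "'a pser" and m :: "'a expo"
    show "(x_check p i \<circ> x_check p j) g m
        = op_scale (p powi commutation_weight i j) (x_check p j \<circ> x_check p i) g m"
    proof (cases "m i = 0 \<or> m j = 0")
      case True
      with False show ?thesis
        by (auto simp: x_check_apply op_scale_def)
    next
      case nz: False
      let ?h = "g (m(i := m i - 1, j := m j - 1))"
      let ?e = "int (m (i - 1)) + 1 - int (m i)" and ?f = "int (m (j - 1)) + 1 - int (m j)"
      have "(x_check p i \<circ> x_check p j) g m = p powi ?e * p powi (?f - of_bool (j - 1 = i)) * ?h"
        using nz False by (auto simp: x_check_apply of_nat_diff algebra_simps)
      also have "\<dots> = p powi (?e + (?f - of_bool (j - 1 = i))) * ?h"
        by (simp only: power_int_add[OF disjI1[OF assms]])
      also have "?e + (?f - of_bool (j - 1 = i))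
          = commutation_weight i j + (?f + (?e - of_bool (i - 1 = j)))"
        by (simp add: commutation_weight_def ij ji)
      also have "p powi \<dots> * ?h
          = p powi commutation_weight i j * (p powi ?f * p powi (?e - of_bool (i - 1 = j)) * ?h)"
        by (simp only: power_int_add[OF disjI1[OF assms]] mult.assoc)
      also have "p powi ?f * p powi (?e - of_bool (i - 1 = j)) * ?h = (x_check p j \<circ> x_check p i) g m"
        using nz False by (auto simp: x_check_apply of_nat_diff algebra_simps fun_upd_twist)
      finally show ?thesis
        by (simp add: op_scale_def)
    qed
  qed
qed

lemma x_hat_eq: "x_hat q d db i = op_scale (d i * db i) (x_check (inverse q) i)"
  by (simp add: x_hat_def x_check_def power_int_inverse flip: power_int_minus)

text \<open>Both families of generators are of this form: \<open>p = q\<close> gives \<^const>\<open>x_check\<close> and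
  \<open>p = inverse q\<close> gives \<^const>\<open>x_hat\<close>.\<close>

definition x_gen :: "complex \<Rightarrow> ('n::nontriv mod_ring \<Rightarrow> complex) \<Rightarrow> 'n mod_ring \<Rightarrow> 'n oper" where
  "x_gen p c i = op_scale (c i) (x_check p i)"

lemma x_check_eq_x_gen: "x_check q = x_gen q (\<lambda>_. 1)"
  and x_hat_eq_x_gen: "x_hat q d db = x_gen (inverse q) (\<lambda>i. d i * db i)"
  by (simp_all add: fun_eq_iff x_gen_def x_hat_eq)

lemma cyclic_generators_x_gen:
  assumes "norm q < 1" "p \<noteq> 0"
  shows "cyclic_generators q p (x_gen p c)"
proof
  show "linear_oper (x_gen p c i)" for i
    by (simp add: x_gen_def linear_oper_op_scale linear_oper_x_check)
  show "raises_degree 1 (x_gen p c i)" for i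
    unfolding x_gen_def by (intro raises_degree_op_scale raises_degree_x_check)
  show "x_gen p c i \<circ> x_gen p c j = op_scale (p powi commutation_weight i j) (x_gen p c j \<circ> x_gen p c i)"
    for i j
    by (simp only: x_gen_def op_scale_comp comp_op_scale[OF linear_oper_x_check] op_scale_op_scale
        x_check_commute[OF assms(2), of i j] mult_ac)
qed (use assms in auto)

section \<open>The product of all variables as a word in the generators\<close>

lemma op_prod_op_var:
  assumes "distinct is"
  shows "op_prod (map op_var is) g m
    = (if \<exists>i\<in>set is. m i = 0 then 0 else g (\<lambda>i. if i \<in> set is then m i - 1 else m i))"
  using assms
proof (induction "is" arbitrary: m)
  case (Cons i "is")
  have "op_prod (map op_var (i # is)) g m = op_var i (op_prod (map op_var is) g) m"
    by (simp only: list.map op_prod_Cons comp_apply)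
  also have "\<dots> = (if m i = 0 then 0 else op_prod (map op_var is) g (m(i := m i - 1)))"
    by (simp add: op_var_def)
  also have "op_prod (map op_var is) g (m(i := m i - 1)) = (if \<exists>j\<in>set is. m j = 0 then 0
      else g (\<lambda>j. if j \<in> set (i # is) then m j - 1 else m j))"
  proof -
    have "(\<exists>j\<in>set is. (m(i := m i - 1)) j = 0) \<longleftrightarrow> (\<exists>j\<in>set is. m j = 0)"
      using Cons.prems by auto
    moreover have "(\<lambda>j. if j \<in> set is then (m(i := m i - 1)) j - 1 else (m(i := m i - 1)) j)
        = (\<lambda>j. if j \<in> set (i # is) then m j - 1 else m j)"
      using Cons.prems by auto
    ultimately show ?thesis
      using Cons.prems by (simp only: Cons.IH distinct.simps)
  qed
  also have "(if m i = 0 then 0 else if \<exists>j\<in>set is. m j = 0 then 0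
        else g (\<lambda>j. if j \<in> set (i # is) then m j - 1 else m j))
      = (if \<exists>j\<in>set (i # is). m j = 0 then 0
        else g (\<lambda>j. if j \<in> set (i # is) then m j - 1 else m j))"
    by (auto simp del: neq0_conv)
  finally show ?case .
qed simp

lemma bij_betw_of_nat_mod_ring:
  "bij_betw (of_nat :: nat \<Rightarrow> 'n::nontriv mod_ring) {0..<CARD('n)} UNIV"
proof -
  have "inj_on (of_nat :: nat \<Rightarrow> 'n mod_ring) {0..<CARD('n)}"
    by (auto simp: inj_on_def of_nat_eq_iff_cong_CHAR cong_def)
  moreover from this have "of_nat ` {0..<CARD('n)} = (UNIV :: 'n mod_ring set)"
    by (intro card_subset_eq) (simp_all add: card_image)
  ultimately show ?thesis
    by (simp add: bij_betw_def)
qed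

lemma op_Lambda_apply:
  "op_Lambda g m = (if \<exists>i. m i = 0 then 0 else g (\<lambda>i. m i - 1))" for m :: "'n::nontriv expo"
proof -
  let ?N = "CARD('n)"
  \<comment> \<open>The list ends with \<open>of_nat CARD('n) = 0\<close>, so it is a rotation of
    the list starting at 0, which enumerates the index type without repetition.\<close>
  have upt: "map of_nat [1..<?N + 1] = map of_nat [1..<?N] @ [0 :: 'n mod_ring]"
    using nontriv[where ?'a = 'n] by simp
  have upt0: "map of_nat [0..<?N] = (0 :: 'n mod_ring) # map of_nat [1..<?N]"
    using nontriv[where ?'a = 'n] by (simp add: upt_conv_Cons)
  have "distinct (map of_nat [0..<?N] :: 'n mod_ring list)"
    "set (map of_nat [0..<?N]) = (UNIV :: 'n mod_ring set)"
    using bij_betw_of_nat_mod_ring[where 'n = 'n] by (auto simp: distinct_map bij_betw_def)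
  then have d: "distinct (map of_nat [1..<?N + 1] :: 'n mod_ring list)"
    and s: "set (map of_nat [1..<?N + 1]) = (UNIV :: 'n mod_ring set)"
    unfolding upt upt0 by auto
  have "op_Lambda g m = op_prod (map op_var (map of_nat [1..<?N + 1])) g m"
    by (simp only: op_Lambda_def map_map comp_def)
  then show ?thesis
    by (simp only: op_prod_op_var[OF d] s UNIV_I if_True bex_UNIV)
qed

lemma raises_degree_op_Lambda: "raises_degree 1 (op_Lambda :: 'n::nontriv oper)"
  unfolding raises_degree_def
proof (intro allI impI)
  fix k and g :: "'n pser" and m :: "'n expo"
  assume g: "\<forall>m. degree_expo m < k \<longrightarrow> g m = 0" and m: "degree_expo m < k + 1"
  have "degree_expo (\<lambda>i. m i - 1) < degree_expo m" if "\<forall>i. m i \<noteq> 0"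
    unfolding degree_expo_def using that by (intro sum_strict_mono) (auto simp: less_Suc_eq_le)
  with g m show "op_Lambda g m = 0"
    by (auto simp: op_Lambda_apply)
qed

text \<open>In descending order each factor reads exponents that have not been lowered yet, so the
  powers of \<open>p\<close> telescope. For \<open>k < CARD('n)\<close> the index -1 is not among
  those lowered.\<close>

lemma op_prod_x_check_descending:
  fixes m :: "'n::nontriv expo"
  assumes "p \<noteq> 0" "0 < k" "k < CARD('n)"
  shows "op_prod (map (\<lambda>j. x_check p (of_nat j)) (rev [0..<k])) g m
    = (if \<exists>j<k. m (of_nat j) = 0 then 0
       else p powi (int k - int (m (of_nat (k - 1))) + int (m (- 1)))
         * g (\<lambda>i. if i \<in> of_nat ` {0..<k} then m i - 1 else m i))"
  using assms(2,3)
proof (induction k arbitrary: m)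
  case (Suc k)
  show ?case
  proof (cases "k = 0")
    case True
    have "(\<lambda>i. if i = 0 then m i - 1 else m i) = m(0 := m 0 - 1)"
      by auto
    with True show ?thesis
      by (simp add: x_check_apply algebra_simps)
  next
    case False
    let ?m' = "m(of_nat k := m (of_nat k) - 1)"
    have inj: "of_nat j = (of_nat k :: 'n mod_ring) \<longleftrightarrow> j = k" if "j < CARD('n)" for j
      using that Suc.prems bij_betw_of_nat_mod_ring[where 'n = 'n] by (auto simp: bij_betw_def inj_on_def)
    have neg: "- 1 = (of_nat (CARD('n) - 1) :: 'n mod_ring)"
      using Suc.prems by (simp add: of_nat_diff)
    have m1: "?m' (- 1) = m (- 1)"
      unfolding neg using inj[of "CARD('n) - 1"] Suc.prems by auto
    have k1: "(of_nat k - 1 :: 'n mod_ring) = of_nat (k - 1)"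
      using False by (simp add: of_nat_diff)
    have mk: "?m' (of_nat (k - 1)) = m (of_nat (k - 1))"
      using inj[of "k - 1"] Suc.prems False by auto
    have nin: "(of_nat k :: 'n mod_ring) \<notin> of_nat ` {0..<k}"
    proof
      assume "(of_nat k :: 'n mod_ring) \<in> of_nat ` {0..<k}"
      then obtain j where "of_nat j = (of_nat k :: 'n mod_ring)" "j < k"
        by auto
      then show False
        using inj[of j] Suc.prems by simp
    qed
    have g: "(\<lambda>i. if i \<in> of_nat ` {0..<k} then ?m' i - 1 else ?m' i)
        = (\<lambda>i. if i \<in> of_nat ` {0..<Suc k} then m i - 1 else m i)"
      using nin by (auto simp: atLeast0_lessThan_Suc)
    have ex: "(\<exists>j<k. ?m' (of_nat j) = 0) \<longleftrightarrow> (\<exists>j<k. m (of_nat j) = 0)"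
      using inj Suc.prems by (intro ex_cong1 conj_cong refl) simp
    have "op_prod (map (\<lambda>j. x_check p (of_nat j)) (rev [0..<Suc k])) g m
        = x_check p (of_nat k) (op_prod (map (\<lambda>j. x_check p (of_nat j)) (rev [0..<k])) g) m"
      by (simp add: comp_def)
    also have "\<dots> = (if m (of_nat k) = 0 then 0
        else p powi (int (m (of_nat (k - 1))) + 1 - int (m (of_nat k)))
          * op_prod (map (\<lambda>j. x_check p (of_nat j)) (rev [0..<k])) g ?m')"
      by (simp only: x_check_apply k1)
    also have "op_prod (map (\<lambda>j. x_check p (of_nat j)) (rev [0..<k])) g ?m'
        = (if \<exists>j<k. m (of_nat j) = 0 then 0
           else p powi (int k - int (m (of_nat (k - 1))) + int (m (- 1)))
             * g (\<lambda>i. if i \<in> of_nat ` {0..<Suc k} then m i - 1 else m i))"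
      using Suc.prems False by (subst Suc.IH) (simp_all only: ex mk m1 g)
    finally have "op_prod (map (\<lambda>j. x_check p (of_nat j)) (rev [0..<Suc k])) g m
        = (if m (of_nat k) = 0 then 0
        else p powi (int (m (of_nat (k - 1))) + 1 - int (m (of_nat k)))
          * (if \<exists>j<k. m (of_nat j) = 0 then 0
           else p powi (int k - int (m (of_nat (k - 1))) + int (m (- 1)))
             * g (\<lambda>i. if i \<in> of_nat ` {0..<Suc k} then m i - 1 else m i)))" .
    moreover have "p powi (int (m (of_nat (k - 1))) + 1 - int (m (of_nat k)))
          * (p powi (int k - int (m (of_nat (k - 1))) + int (m (- 1))) * x)
        = p powi (int (Suc k) - int (m (of_nat (Suc k - 1))) + int (m (- 1))) * x" for x
      by (simp add: mult.assoc[symmetric] power_int_add[OF disjI1[OF assms(1)], symmetric])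
        (simp add: algebra_simps)
    ultimately show ?thesis
      by (auto simp: less_Suc_eq simp del: neq0_conv)
  qed
qed simp

text \<open>The last generator closes the cycle: its index is -1, whose exponent is already lowered
  when the telescoped sum reads it. This reduces the exponent of \<open>p\<close> from N to N -
  1.\<close>

lemma op_Lambda_eq_descending:
  assumes "p \<noteq> 0"
  shows "op_prod (map (\<lambda>j. x_check p (of_nat j)) (rev [0..<CARD('n)]))
    = op_scale (p powi (int CARD('n) - 1)) (op_Lambda :: 'n::nontriv oper)"
proof (intro ext)
  fix g and m :: "'n expo"
  obtain k where N: "CARD('n) = Suc k" and k: "0 < k"
    using nontriv[where ?'a = 'n] by (auto elim: lessE)
  let ?m' = "m(of_nat k := m (of_nat k) - 1)"
  have neg: "- 1 = (of_nat k :: 'n mod_ring)"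
    using of_nat_card_eq_0[where 'a = 'n] unfolding N of_nat_Suc by (rule minus_unique)
  have inj: "of_nat j = (of_nat k :: 'n mod_ring) \<longleftrightarrow> j = k" if "j < CARD('n)" for j
    using that bij_betw_of_nat_mod_ring[where 'n = 'n] N by (auto simp: bij_betw_def inj_on_def)
  have UNIV_eq: "UNIV = insert (of_nat k) (of_nat ` {0..<k} :: 'n mod_ring set)"
    using bij_betw_of_nat_mod_ring[where 'n = 'n] unfolding N bij_betw_def atLeast0_lessThan_Suc by simp
  have all: "(\<exists>i. m i = 0) \<longleftrightarrow> m (of_nat k) = 0 \<or> (\<exists>j<k. m (of_nat j) = 0)"
    unfolding bex_UNIV[symmetric] UNIV_eq by auto
  have nin: "(of_nat k :: 'n mod_ring) \<notin> of_nat ` {0..<k}"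
  proof
    assume "(of_nat k :: 'n mod_ring) \<in> of_nat ` {0..<k}"
    then obtain j where "of_nat j = (of_nat k :: 'n mod_ring)" "j < k"
      by auto
    then show False
      using inj[of j] N by simp
  qed
  have g: "(\<lambda>i. if i \<in> of_nat ` {0..<k} then ?m' i - 1 else ?m' i) = (\<lambda>i. m i - 1)"
    using UNIV_eq nin by (auto simp: fun_eq_iff)
  have ex: "(\<exists>j<k. ?m' (of_nat j) = 0) \<longleftrightarrow> (\<exists>j<k. m (of_nat j) = 0)"
    using inj N by (intro ex_cong1 conj_cong refl) simp
  have k1: "(of_nat k - 1 :: 'n mod_ring) = of_nat (k - 1)"
    using k by (simp add: of_nat_diff)
  have mk: "?m' (of_nat (k - 1)) = m (of_nat (k - 1))"
    using inj[of "k - 1"] N k by auto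
  have "op_prod (map (\<lambda>j. x_check p (of_nat j)) (rev [0..<CARD('n)])) g m
      = x_check p (of_nat k) (op_prod (map (\<lambda>j. x_check p (of_nat j)) (rev [0..<k])) g) m"
    by (simp add: N comp_def)
  also have "\<dots> = (if m (of_nat k) = 0 then 0
      else p powi (int (m (of_nat (k - 1))) + 1 - int (m (of_nat k)))
        * op_prod (map (\<lambda>j. x_check p (of_nat j)) (rev [0..<k])) g ?m')"
    by (simp only: x_check_apply k1)
  also have "op_prod (map (\<lambda>j. x_check p (of_nat j)) (rev [0..<k])) g ?m'
      = (if \<exists>j<k. m (of_nat j) = 0 then 0
         else p powi (int k - int (m (of_nat (k - 1))) + int (?m' (of_nat k))) * g (\<lambda>i. m i - 1))"
    using k N by (subst op_prod_x_check_descending[OF assms]) (simp_all only: ex mk g neg)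
  finally have "op_prod (map (\<lambda>j. x_check p (of_nat j)) (rev [0..<CARD('n)])) g m
      = (if m (of_nat k) = 0 then 0
      else p powi (int (m (of_nat (k - 1))) + 1 - int (m (of_nat k)))
        * (if \<exists>j<k. m (of_nat j) = 0 then 0
         else p powi (int k - int (m (of_nat (k - 1))) + int (?m' (of_nat k))) * g (\<lambda>i. m i - 1)))" .
  moreover have "p powi (int (m (of_nat (k - 1))) + 1 - int (m (of_nat k)))
        * (p powi (int k - int (m (of_nat (k - 1))) + int (?m' (of_nat k))) * x)
      = p powi (int CARD('n) - 1) * x" if "m (of_nat k) \<noteq> 0" for x
    using that by (simp add: N of_nat_diff mult.assoc[symmetric] power_int_add[OF disjI1[OF assms(1)], symmetric])
  ultimately show "op_prod (map (\<lambda>j. x_check p (of_nat j)) (rev [0..<CARD('n)])) g m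
      = op_scale (p powi (int CARD('n) - 1)) op_Lambda g m"
    unfolding op_scale_def op_Lambda_apply all by (auto simp del: neq0_conv)
qed

section \<open>Completed algebras and conjugation\<close>

lemma gen_algebra_linear_raises:
  assumes "\<And>i. linear_oper (G i)" "\<And>i. raises_degree 1 (G i)" "X \<in> gen_algebra G"
  shows "linear_oper X \<and> raises_degree 0 X"
  using assms(3)
proof induction
  case (gen i)
  then show ?case
    using assms(1,2) raises_degree_mono[of 1 _ 0] by auto
next
  case (mult X Y)
  then show ?case
    using raises_degree_comp[of 0 X 0 Y] linear_oper_comp[of X Y] by (simp only: add_0_left)
qed (simp_all only: linear_oper_id raises_degree_id linear_oper_plus raises_degree_plus
    linear_oper_op_scale raises_degree_op_scale simp_thms)

lemma gen_algebra_funpow: "X \<in> gen_algebra G \<Longrightarrow> X ^^ n \<in> gen_algebra G"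
  by (induction n) (auto intro: gen_algebra.intros simp only: funpow.simps)

lemma gen_algebra_op_prod: "set Ts \<subseteq> gen_algebra G \<Longrightarrow> op_prod Ts \<in> gen_algebra G"
  by (induction Ts) (auto intro: gen_algebra.intros simp only: op_prod_Nil op_prod_Cons list.set)

lemma gen_algebra_word: "op_prod (map G is) \<in> gen_algebra G"
  by (rule gen_algebra_op_prod) (auto intro: gen_algebra.gen)

lemma completed_algebraE:
  assumes "X \<in> completed_algebra G"
  obtains Y where "Y \<in> gen_algebra G" "raises_degree n (X - Y)"
  using assms by (auto simp: completed_algebra_def)

lemma gen_algebra_subset_completed: "X \<in> gen_algebra G \<Longrightarrow> X \<in> completed_algebra G"
proof -
  assume X: "X \<in> gen_algebra G"
  have "raises_degree n (X - X)" for n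
    by (simp add: raises_degree_def)
  with X show ?thesis
    unfolding completed_algebra_def by blast
qed

lemma completed_algebra_plus:
  assumes "X \<in> completed_algebra G" "Y \<in> completed_algebra G"
  shows "X + Y \<in> completed_algebra G"
  unfolding completed_algebra_def
proof safe
  fix n
  obtain X' where X': "X' \<in> gen_algebra G" "raises_degree n (X - X')"
    using assms(1) by (rule completed_algebraE)
  obtain Y' where Y': "Y' \<in> gen_algebra G" "raises_degree n (Y - Y')"
    using assms(2) by (rule completed_algebraE)
  show "\<exists>Z\<in>gen_algebra G. raises_degree n (X + Y - Z)"
  proof
    show "X' + Y' \<in> gen_algebra G"
      using X'(1) Y'(1) by (rule gen_algebra.add)
    show "raises_degree n (X + Y - (X' + Y'))"
      unfolding add_diff_add using X'(2) Y'(2) by (rule raises_degree_plus)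
  qed
qed

lemma op_scale_minus: "op_scale c (X - Y) = op_scale c X - op_scale c Y"
  by (simp add: op_scale_def fun_eq_iff algebra_simps)

lemma completed_algebra_op_scale:
  assumes "X \<in> completed_algebra G"
  shows "op_scale c X \<in> completed_algebra G"
  unfolding completed_algebra_def
proof safe
  fix n
  obtain Y where Y: "Y \<in> gen_algebra G" "raises_degree n (X - Y)"
    using assms by (rule completed_algebraE)
  show "\<exists>Z\<in>gen_algebra G. raises_degree n (op_scale c X - Z)"
  proof
    show "op_scale c Y \<in> gen_algebra G"
      using Y(1) by (rule gen_algebra.scale)
    show "raises_degree n (op_scale c X - op_scale c Y)"
      unfolding op_scale_minus[symmetric] using Y(2) by (rule raises_degree_op_scale)
  qed
qed

lemma completed_algebra_minus:
  assumes "X \<in> completed_algebra G" "Y \<in> completed_algebra G"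
  shows "X - Y \<in> completed_algebra G"
proof -
  have "X - Y = X + op_scale (-1) Y"
    by (simp add: op_scale_def fun_eq_iff)
  then show ?thesis
    using assms by (simp only: completed_algebra_plus completed_algebra_op_scale)
qed

lemma cyclic_shift_automorphismD:
  assumes "cyclic_shift_automorphism G \<pi>"
  shows "\<And>X Y. X \<in> completed_algebra G \<Longrightarrow> Y \<in> completed_algebra G \<Longrightarrow> \<pi> (X + Y) = \<pi> X + \<pi> Y"
    and "\<And>c X. X \<in> completed_algebra G \<Longrightarrow> \<pi> (op_scale c X) = op_scale c (\<pi> X)"
    and "\<And>X Y. X \<in> completed_algebra G \<Longrightarrow> Y \<in> completed_algebra G \<Longrightarrow> \<pi> (X \<circ> Y) = \<pi> X \<circ> \<pi> Y"
    and "\<pi> id = id"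
    and "\<And>i. \<pi> (G i) = G (i + 1)"
    and "\<And>n. \<exists>k. \<forall>X\<in>completed_algebra G. raises_degree k X \<longrightarrow> raises_degree n (\<pi> X)"
proof -
  note h = assms[unfolded cyclic_shift_automorphism_def, THEN conjunct2]
  show "\<pi> (X + Y) = \<pi> X + \<pi> Y" if "X \<in> completed_algebra G" "Y \<in> completed_algebra G" for X Y
    by (rule h[THEN conjunct1, rule_format, OF that])
  show "\<pi> (op_scale c X) = op_scale c (\<pi> X)" if "X \<in> completed_algebra G" for c X
    by (rule h[THEN conjunct2, THEN conjunct1, rule_format, OF that])
  show "\<pi> (X \<circ> Y) = \<pi> X \<circ> \<pi> Y" if "X \<in> completed_algebra G" "Y \<in> completed_algebra G" for X Y
    by (rule h[THEN conjunct2, THEN conjunct2, THEN conjunct1, rule_format, OF that])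
  show "\<pi> id = id"
    by (rule h[THEN conjunct2, THEN conjunct2, THEN conjunct2, THEN conjunct1])
  show "\<pi> (G i) = G (i + 1)" for i
    by (rule h[THEN conjunct2, THEN conjunct2, THEN conjunct2, THEN conjunct2, THEN conjunct1, rule_format])
  show "\<exists>k. \<forall>X\<in>completed_algebra G. raises_degree k X \<longrightarrow> raises_degree n (\<pi> X)" for n
    by (rule h[THEN conjunct2, THEN conjunct2, THEN conjunct2, THEN conjunct2, THEN conjunct2, THEN spec])
qed

context
  fixes G :: "'n::nontriv mod_ring \<Rightarrow> 'n oper"
  assumes linear_G: "\<And>i. linear_oper (G i)" and raises_G: "\<And>i. raises_degree 1 (G i)"
begin

lemma completed_algebra_raises_0:
  assumes "X \<in> completed_algebra G"
  shows "raises_degree 0 X"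
proof -
  obtain Y where "Y \<in> gen_algebra G" "raises_degree 0 (X - Y)"
    using assms by (rule completed_algebraE)
  then have "raises_degree 0 (X - Y + Y)"
    using gen_algebra_linear_raises[OF linear_G raises_G] by (intro raises_degree_plus) simp_all
  then show ?thesis by simp
qed

text \<open>The difference splits as (X - X') Y + X' (Y - Y'). Linearity is used for
  \<open>X'\<close>, which lies in the algebra itself.\<close>

lemma completed_algebra_comp:
  assumes "X \<in> completed_algebra G" "Y \<in> completed_algebra G"
  shows "X \<circ> Y \<in> completed_algebra G"
  unfolding completed_algebra_def
proof safe
  fix n
  obtain X' where X': "X' \<in> gen_algebra G" "raises_degree n (X - X')"
    using assms(1) by (rule completed_algebraE)
  obtain Y' where Y': "Y' \<in> gen_algebra G" "raises_degree n (Y - Y')"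
    using assms(2) by (rule completed_algebraE)
  have lin: "linear_oper X'" and raises: "raises_degree 0 X'"
    using gen_algebra_linear_raises[OF linear_G raises_G X'(1)] by auto
  have "(X \<circ> Y) - (X' \<circ> Y') = ((X - X') \<circ> Y) + (X' \<circ> (Y - Y'))"
    by (simp add: fun_eq_iff linear_oper_diff[OF lin])
  moreover have "raises_degree (n + 0) ((X - X') \<circ> Y)" "raises_degree (0 + n) (X' \<circ> (Y - Y'))"
    by (intro raises_degree_comp X' Y' raises completed_algebra_raises_0 assms)+
  ultimately have "raises_degree n ((X \<circ> Y) - (X' \<circ> Y'))"
    by (simp only: raises_degree_plus add_0_left add_0_right)
  then show "\<exists>Z\<in>gen_algebra G. raises_degree n ((X \<circ> Y) - Z)"
    by (rule bexI[OF _ gen_algebra.mult[OF X'(1) Y'(1)]])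
qed

lemma completed_algebra_op_prod: "set Ts \<subseteq> completed_algebra G \<Longrightarrow> op_prod Ts \<in> completed_algebra G"
proof (induction Ts)
  case Nil
  then show ?case
    by (simp only: op_prod_Nil gen_algebra_subset_completed gen_algebra.one)
next
  case (Cons T Ts)
  then show ?case
    unfolding op_prod_Cons by (intro completed_algebra_comp) simp_all
qed

lemma completed_algebra_op_series:
  assumes "T \<in> gen_algebra G" "raises_degree 1 T"
  shows "op_series F T \<in> completed_algebra G"
  unfolding completed_algebra_def
proof safe
  fix M
  have "(\<lambda>g m. \<Sum>n<M. F $ n * (T ^^ n) g m) \<in> gen_algebra G"
  proof (induction M)
    case 0
    have "op_scale 0 id \<in> gen_algebra G"
      by (intro gen_algebra.scale gen_algebra.one)
    then show ?case
      by (simp add: op_scale_def)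
  next
    case (Suc M)
    have "(\<lambda>g m. \<Sum>n<Suc M. F $ n * (T ^^ n) g m)
        = (\<lambda>g m. \<Sum>n<M. F $ n * (T ^^ n) g m) + op_scale (F $ M) (T ^^ M)"
      by (simp add: op_scale_def fun_eq_iff)
    also have "\<dots> \<in> gen_algebra G"
      by (intro gen_algebra.add gen_algebra.scale gen_algebra_funpow Suc assms)
    finally show ?case .
  qed
  then show "\<exists>Z\<in>gen_algebra G. raises_degree M (op_series F T - Z)"
    by (rule bexI[rotated]) (rule raises_degree_op_series_minus[OF assms(2)])
qed

lemma completed_algebra_e_word:
  assumes "is \<noteq> []"
  shows "e_word q G is \<in> completed_algebra G"
  unfolding e_word_def op_e_def
proof (intro completed_algebra_op_series gen_algebra.scale gen_algebra_word raises_degree_op_scale)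
  show "raises_degree 1 (op_prod (map G is))"
    using raises_G assms by (rule raises_degree_word)
qed

lemma product_L_in_completed: "product_L q G \<in> completed_algebra G"
  and product_R_in_completed: "product_R q G \<in> completed_algebra G"
  unfolding product_L_def product_R_def
  by (intro completed_algebra_comp completed_algebra_op_prod; force intro!: completed_algebra_e_word)+

text \<open>Both maps agree on the algebra by induction on its elements. The algebra is dense in its
  completion, and the continuity condition makes the images of a remainder of order
  \<open>max k l\<close> as small as required.\<close>

lemma cyclic_shift_automorphism_unique:
  assumes \<pi>: "cyclic_shift_automorphism G \<pi>" and \<rho>: "cyclic_shift_automorphism G \<rho>"
    and X: "X \<in> completed_algebra G"
  shows "\<pi> X = \<rho> X"
proof (rule raises_degree_eqI)
  fix n
  have gen: "\<pi> Y = \<rho> Y" if "Y \<in> gen_algebra G" for Y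
    using that
  proof induction
    case (gen i)
    show ?case
      by (simp only: cyclic_shift_automorphismD(5)[OF \<pi>] cyclic_shift_automorphismD(5)[OF \<rho>])
  next
    case one
    show ?case
      by (simp only: cyclic_shift_automorphismD(4)[OF \<pi>] cyclic_shift_automorphismD(4)[OF \<rho>])
  next
    case (add X Y)
    then show ?case
      by (simp only: cyclic_shift_automorphismD(1)[OF \<pi>] cyclic_shift_automorphismD(1)[OF \<rho>]
          gen_algebra_subset_completed)
  next
    case (scale X c)
    then show ?case
      by (simp only: cyclic_shift_automorphismD(2)[OF \<pi>] cyclic_shift_automorphismD(2)[OF \<rho>]
          gen_algebra_subset_completed)
  next
    case (mult X Y)
    then show ?case
      by (simp only: cyclic_shift_automorphismD(3)[OF \<pi>] cyclic_shift_automorphismD(3)[OF \<rho>]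
          gen_algebra_subset_completed)
  qed
  obtain k where k: "\<And>Z. Z \<in> completed_algebra G \<Longrightarrow> raises_degree k Z \<Longrightarrow> raises_degree n (\<pi> Z)"
    using cyclic_shift_automorphismD(6)[OF \<pi>] by blast
  obtain l where l: "\<And>Z. Z \<in> completed_algebra G \<Longrightarrow> raises_degree l Z \<Longrightarrow> raises_degree n (\<rho> Z)"
    using cyclic_shift_automorphismD(6)[OF \<rho>] by blast
  obtain Y where Y: "Y \<in> gen_algebra G" "raises_degree (max k l) (X - Y)"
    using X by (rule completed_algebraE)
  have Y': "Y \<in> completed_algebra G"
    using Y(1) by (rule gen_algebra_subset_completed)
  have XY: "X - Y \<in> completed_algebra G"
    using X Y' by (rule completed_algebra_minus)
  have add: "\<sigma> X = \<sigma> (X - Y) + \<sigma> Y" if "cyclic_shift_automorphism G \<sigma>" for \<sigma>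
    using cyclic_shift_automorphismD(1)[OF that XY Y'] by (simp only: diff_add_cancel)
  have "\<pi> X - \<rho> X = \<pi> (X - Y) - \<rho> (X - Y)"
    by (simp only: add[OF \<pi>] add[OF \<rho>] gen[OF Y(1)] add_diff_cancel_right)
  moreover have "raises_degree k (X - Y)" "raises_degree l (X - Y)"
    using Y(2) by (rule raises_degree_mono, simp)+
  then have "raises_degree n (\<pi> (X - Y) - \<rho> (X - Y))"
    by (intro raises_degree_minus[OF k l] XY)
  ultimately show "raises_degree n (\<pi> X - \<rho> X)"
    by simp
qed

end

section \<open>Conjugation by invertible operators that preserve degrees\<close>

locale conjugation =
  fixes S S' :: "'n::nontriv oper"
  assumes linear: "linear_oper S" "linear_oper S'"
    and raises: "raises_degree 0 S" "raises_degree 0 S'"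
    and inverse: "S \<circ> S' = id" "S' \<circ> S = id"
begin

definition conjugate :: "'n oper \<Rightarrow> 'n oper" where
  "conjugate X = S \<circ> X \<circ> S'"

lemma conjugate_eqI: "S \<circ> X = Y \<circ> S \<Longrightarrow> conjugate X = Y"
  by (simp only: conjugate_def comp_assoc inverse comp_id)

lemma comp_conjugate: "S \<circ> X = conjugate X \<circ> S"
  by (simp only: conjugate_def comp_assoc inverse comp_id)

lemma conjugate_id: "conjugate id = id"
  by (rule conjugate_eqI) simp

lemma conjugate_comp: "conjugate (X \<circ> Y) = conjugate X \<circ> conjugate Y"
proof (rule conjugate_eqI)
  have "S \<circ> (X \<circ> Y) = (S \<circ> X) \<circ> Y"
    by (simp only: comp_assoc)
  then show "S \<circ> (X \<circ> Y) = conjugate X \<circ> conjugate Y \<circ> S"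
    by (simp only: comp_conjugate comp_assoc)
qed

lemma conjugate_plus: "conjugate (X + Y) = conjugate X + conjugate Y"
  and conjugate_minus: "conjugate (X - Y) = conjugate X - conjugate Y"
  by (simp_all only: conjugate_def comp_plus[OF linear(1)] comp_minus[OF linear(1)] plus_comp minus_comp)

lemma conjugate_op_scale: "conjugate (op_scale c X) = op_scale c (conjugate X)"
  by (simp only: conjugate_def comp_op_scale[OF linear(1)] op_scale_comp)

lemma raises_degree_conjugate: "raises_degree n X \<Longrightarrow> raises_degree n (conjugate X)"
  unfolding conjugate_def using raises_degree_comp[OF raises_degree_comp[OF raises(1)] raises(2)] by simp

lemma conjugate_op_prod: "conjugate (op_prod Ts) = op_prod (map conjugate Ts)"
  by (induction Ts) (simp_all only: op_prod_Nil op_prod_Cons list.map conjugate_id conjugate_comp)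

lemma conjugate_op_series:
  assumes "raises_degree 1 T"
  shows "conjugate (op_series F T) = op_series F (conjugate T)"
  by (intro conjugate_eqI op_series_intertwine linear raises assms raises_degree_conjugate comp_conjugate)

lemma conjugate_e_word:
  assumes "is \<noteq> []" "\<And>i. raises_degree 1 (G i)"
  shows "conjugate (e_word q G is) = e_word q (\<lambda>i. conjugate (G i)) is"
proof -
  have "raises_degree 1 (op_prod (map G is))"
    using assms(2,1) by (rule raises_degree_word)
  then show ?thesis
    unfolding e_word_def op_e_def
    by (simp only: conjugate_op_series raises_degree_op_scale conjugate_op_scale conjugate_op_prod map_map comp_def)
qed

lemma conjugate_product:
  assumes "\<And>i. raises_degree 1 (G i)"
  shows "conjugate (product_L q G) = product_L q (\<lambda>i. conjugate (G i))"
    and "conjugate (product_R q G) = product_R q (\<lambda>i. conjugate (G i))"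
proof -
  have "map (\<lambda>k. conjugate (e_word q G (w k))) ks = map (\<lambda>k. e_word q (\<lambda>i. conjugate (G i)) (w k)) ks"
    if "\<And>k. w k \<noteq> []" for w and ks :: "nat list"
    using that by (simp only: conjugate_e_word assms not_False_eq_True cong: map_cong)
  note map_conj = this[of "\<lambda>k. map of_nat [0..<k + 1]"] this[of "\<lambda>k. [of_nat k]"]
    this[of "\<lambda>k. rev (map of_nat [0..<k + 1])"]
  show "conjugate (product_L q G) = product_L q (\<lambda>i. conjugate (G i))"
    "conjugate (product_R q G) = product_R q (\<lambda>i. conjugate (G i))"
    unfolding product_L_def product_R_def conjugate_comp conjugate_op_prod map_map comp_apply
    by (subst map_conj; simp)+
qed

lemma conjugate_gen_algebra:
  assumes "\<And>i. conjugate (G i) \<in> gen_algebra G" "X \<in> gen_algebra G"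
  shows "conjugate X \<in> gen_algebra G"
  using assms(2)
  by induction (auto simp only: conjugate_id conjugate_plus conjugate_op_scale conjugate_comp assms(1) intro: gen_algebra.intros)

lemma conjugate_completed_algebra:
  assumes "\<And>i. conjugate (G i) \<in> gen_algebra G" "X \<in> completed_algebra G"
  shows "conjugate X \<in> completed_algebra G"
  unfolding completed_algebra_def
proof safe
  fix n
  obtain Y where Y: "Y \<in> gen_algebra G" "raises_degree n (X - Y)"
    using assms(2) by (rule completed_algebraE)
  show "\<exists>Z\<in>gen_algebra G. raises_degree n (conjugate X - Z)"
  proof
    show "conjugate Y \<in> gen_algebra G"
      using assms(1) Y(1) by (rule conjugate_gen_algebra)
    show "raises_degree n (conjugate X - conjugate Y)"
      unfolding conjugate_minus[symmetric] using Y(2) by (rule raises_degree_conjugate)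
  qed
qed

text \<open>The reverse conjugation shifts the generators back and so preserves the completed
  algebra, which gives bijectivity. Continuity holds with \<open>k = n\<close>.\<close>

lemma cyclic_shift_automorphism_conjugate:
  assumes conjugate_G: "\<And>i. conjugate (G i) = G (i + 1)"
  shows "cyclic_shift_automorphism G conjugate"
proof -
  interpret inv: conjugation S' S
    by unfold_locales (simp_all add: linear raises inverse)
  have inv_conjugate: "inv.conjugate (conjugate X) = X" and conjugate_inv: "conjugate (inv.conjugate X) = X" for X
  proof -
    have "inv.conjugate (conjugate X) = (S' \<circ> S) \<circ> X \<circ> (S' \<circ> S)" "conjugate (inv.conjugate X) = (S \<circ> S') \<circ> X \<circ> (S \<circ> S')"
      by (simp_all only: inv.conjugate_def conjugate_def comp_assoc)
    then show "inv.conjugate (conjugate X) = X" "conjugate (inv.conjugate X) = X"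
      by (simp_all only: inverse comp_id id_comp)
  qed
  have inv_G: "inv.conjugate (G i) = G (i - 1)" for i
    using inv_conjugate[of "G (i - 1)"] by (simp only: conjugate_G diff_add_cancel)
  have gen: "conjugate (G i) \<in> gen_algebra G" "inv.conjugate (G i) \<in> gen_algebra G" for i
    unfolding conjugate_G inv_G by (rule gen_algebra.gen)+
  have bij: "bij_betw conjugate (completed_algebra G) (completed_algebra G)"
  proof (rule bij_betw_byWitness[where f' = inv.conjugate])
    show "conjugate ` completed_algebra G \<subseteq> completed_algebra G"
      using conjugate_completed_algebra[OF gen(1)] by (rule image_subsetI)
    show "inv.conjugate ` completed_algebra G \<subseteq> completed_algebra G"
      using inv.conjugate_completed_algebra[OF gen(2)] by (rule image_subsetI)
  qed (simp_all only: inv_conjugate conjugate_inv simp_thms ball_triv)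
  show ?thesis
    unfolding cyclic_shift_automorphism_def
  proof (intro conjI allI ballI)
    fix n
    show "\<exists>k. \<forall>X\<in>completed_algebra G. raises_degree k X \<longrightarrow> raises_degree n (conjugate X)"
      using raises_degree_conjugate by blast
  qed (rule bij conjugate_plus conjugate_op_scale conjugate_comp conjugate_id conjugate_G)+
qed

end

text \<open>The substitution of \<open>u (i + 1)\<close> times the variable of index
  \<open>i + 1\<close> for the variable of index \<open>i\<close>. With \<open>u = 1\<close> it is
  the relabelling; the scaling serves to absorb the index-dependent factors of the hatted
  generators.\<close>

definition twist :: "('n::nontriv mod_ring \<Rightarrow> complex) \<Rightarrow> 'n oper" where
  "twist u g m = (\<Prod>i\<in>UNIV. u i ^ m i) * g (\<lambda>i. m (i + 1))"

definition twist_inv :: "('n::nontriv mod_ring \<Rightarrow> complex) \<Rightarrow> 'n oper" where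
  "twist_inv u g m = g (\<lambda>i. m (i - 1)) / (\<Prod>i\<in>UNIV. u i ^ m (i - 1))"

lemma bij_plus_one_mod_ring: "bij (\<lambda>i :: 'n::nontriv mod_ring. i + 1)"
  by (rule bij_plus_right)

lemma sum_shift_mod_ring: "(\<Sum>i\<in>UNIV. f (i + 1)) = (\<Sum>i\<in>(UNIV :: 'n::nontriv mod_ring set). f i)"
  and prod_shift_mod_ring: "(\<Prod>i\<in>UNIV. h (i + 1)) = (\<Prod>i\<in>(UNIV :: 'n::nontriv mod_ring set). h i)"
  using sum.reindex_bij_betw[OF bij_plus_one_mod_ring, of f]
    prod.reindex_bij_betw[OF bij_plus_one_mod_ring, of h] by simp_all

lemma conjugation_twist:
  assumes u: "\<And>i. u i \<noteq> 0"
  shows "conjugation (twist u) (twist_inv u)"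
proof
  show "linear_oper (twist u)" "linear_oper (twist_inv u)"
    by (auto simp: linear_oper_def fun_eq_iff twist_def twist_inv_def algebra_simps add_divide_distrib)
  have deg: "degree_expo (\<lambda>i. m (i + 1)) = degree_expo m" "degree_expo (\<lambda>i. m (i - 1)) = degree_expo m"
    for m :: "'a expo"
    using sum_shift_mod_ring[of m] sum_shift_mod_ring[of "\<lambda>i. m (i - 1)"] by (simp_all add: degree_expo_def)
  show "raises_degree 0 (twist u)" "raises_degree 0 (twist_inv u)"
    by (auto simp: raises_degree_def twist_def twist_inv_def deg)
  show "twist u \<circ> twist_inv u = id" "twist_inv u \<circ> twist u = id"
    using u by (auto simp: fun_eq_iff twist_def twist_inv_def)
qed

lemma prod_power_decrement:
  fixes m :: "'n::nontriv expo" and u :: "'n mod_ring \<Rightarrow> complex"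
  assumes "m i \<noteq> 0"
  shows "(\<Prod>j\<in>UNIV. u j ^ m j) = u i * (\<Prod>j\<in>UNIV. u j ^ (m(i := m i - 1)) j)"
proof -
  have "(\<Prod>j\<in>UNIV. u j ^ m j) = u i ^ m i * (\<Prod>j\<in>UNIV - {i}. u j ^ m j)"
    by (rule prod.remove) simp_all
  moreover have "(\<Prod>j\<in>UNIV. u j ^ (m(i := m i - 1)) j) = u i ^ (m i - 1) * (\<Prod>j\<in>UNIV - {i}. u j ^ m j)"
    by (subst prod.remove[of _ i]) (auto intro!: prod.cong)
  moreover have "u i ^ m i = u i * u i ^ (m i - 1)"
    using assms by (cases "m i") simp_all
  ultimately show ?thesis
    by (simp only: mult.assoc)
qed

lemma twist_op_var: "twist u \<circ> op_var i = op_scale (u (i + 1)) (op_var (i + 1) \<circ> twist u)"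
proof (intro ext)
  fix g and m :: "'a expo"
  have "(\<lambda>j. m (j + 1))(i := m (i + 1) - 1) = (\<lambda>j. (m(i + 1 := m (i + 1) - 1)) (j + 1))"
    by auto
  then show "(twist u \<circ> op_var i) g m = op_scale (u (i + 1)) (op_var (i + 1) \<circ> twist u) g m"
    using prod_power_decrement[of m "i + 1" u]
    by (simp add: twist_def op_var_def op_scale_def)
qed

lemma twist_op_diag: "twist u \<circ> op_diag h = op_diag (\<lambda>m. h (\<lambda>i. m (i + 1))) \<circ> twist u"
  by (simp add: fun_eq_iff twist_def op_diag_def)

lemma twist_x_gen:
  assumes "linear_oper (twist u)" "c i * u (i + 1) = c' (i + 1)"
  shows "twist u \<circ> x_gen p c i = x_gen p c' (i + 1) \<circ> twist u"
proof -
  have x_gen: "x_gen p c i = op_scale (c i) (op_var i \<circ> op_diag (\<lambda>m. p powi (- int (m i) + int (m (i - 1)))))"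
    for c and i :: "'a mod_ring"
    by (simp only: x_gen_def x_check_def)
  have "twist u \<circ> x_gen p c i
      = op_scale (c i) ((twist u \<circ> op_var i) \<circ> op_diag (\<lambda>m. p powi (- int (m i) + int (m (i - 1)))))"
    by (simp only: x_gen comp_op_scale[OF assms(1)] comp_assoc)
  also have "\<dots> = op_scale (c i * u (i + 1)) (op_var (i + 1)
      \<circ> (twist u \<circ> op_diag (\<lambda>m. p powi (- int (m i) + int (m (i - 1))))))"
    by (simp only: twist_op_var op_scale_comp op_scale_op_scale comp_assoc)
  also have "\<dots> = x_gen p c' (i + 1) \<circ> twist u"
    by (simp only: twist_op_diag x_gen op_scale_comp comp_assoc assms(2) diff_add_cancel add_diff_cancel_right')
  finally show ?thesis .
qed

text \<open>The shift permutes the variables, and the rescaling multiplies their product by the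
  product of all \<open>u i\<close>, which is 1.\<close>

lemma twist_op_Lambda:
  fixes u :: "'n::nontriv mod_ring \<Rightarrow> complex"
  assumes "prod u UNIV = 1"
  shows "twist u \<circ> op_Lambda = op_Lambda \<circ> twist u"
proof (intro ext)
  fix g and m :: "'n expo"
  have ex: "(\<exists>i. m (i + 1) = 0) \<longleftrightarrow> (\<exists>i. m i = 0)"
  proof
    assume "\<exists>i. m i = 0"
    then obtain i where "m (i - 1 + 1) = 0" by auto
    then show "\<exists>i. m (i + 1) = 0" ..
  qed auto
  show "(twist u \<circ> op_Lambda) g m = (op_Lambda \<circ> twist u) g m"
  proof (cases "\<exists>i. m i = 0")
    case True
    then show ?thesis
      by (simp only: comp_apply twist_def op_Lambda_apply ex if_True mult_zero_right)
  next
    case False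
    have power: "u i ^ m i = u i * u i ^ (m i - 1)" for i
    proof -
      have "m i \<noteq> 0"
        by (rule contrapos_nn[OF False]) (rule exI)
      then show ?thesis by (cases "m i") simp_all
    qed
    have "(\<Prod>i\<in>UNIV. u i ^ m i) = (\<Prod>i\<in>UNIV. u i * u i ^ (m i - 1))"
      by (rule prod.cong[OF refl]) (rule power)
    also have "\<dots> = (\<Prod>i\<in>UNIV. u i ^ (m i - 1))"
      by (simp only: prod.distrib assms mult_1_left)
    finally have prod_eq: "(\<Prod>i\<in>UNIV. u i ^ m i) = (\<Prod>i\<in>UNIV. u i ^ (m i - 1))" .
    have "(twist u \<circ> op_Lambda) g m = (\<Prod>i\<in>UNIV. u i ^ m i) * op_Lambda g (\<lambda>i. m (i + 1))"
      by (simp only: comp_apply twist_def)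
    also have "op_Lambda g (\<lambda>i. m (i + 1)) = g (\<lambda>i. m (i + 1) - 1)"
      unfolding op_Lambda_apply ex by (rule if_not_P[OF False])
    also have "(\<Prod>i\<in>UNIV. u i ^ m i) * \<dots> = twist u g (\<lambda>i. m i - 1)"
      by (simp only: prod_eq twist_def)
    also have "\<dots> = (op_Lambda \<circ> twist u) g m"
      unfolding comp_apply op_Lambda_apply by (rule if_not_P[OF False, symmetric])
    finally show ?thesis .
  qed
qed

section \<open>The central factors and the action of the shift on the ordered products\<close>

lemma op_prod_op_scale:
  assumes "\<And>j. linear_oper (X j)"
  shows "op_prod (map (\<lambda>j. op_scale (c j) (X j)) js) = op_scale (prod_list (map c js)) (op_prod (map X js))"
proof (induction js)
  case (Cons j js)
  then show ?case
    by (simp only: list.map op_prod_Cons op_scale_comp comp_op_scale[OF assms] op_scale_op_scale prod_list.Cons)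
qed simp

text \<open>The descending word in all generators is a nonzero multiple of \<open>op_Lambda\<close>,
  and dividing by that scalar gives any multiple. This places the arguments of the two central
  factors in the algebra.\<close>

lemma op_scale_op_Lambda_in_gen_algebra:
  fixes c :: "'n::nontriv mod_ring \<Rightarrow> complex"
  assumes p: "p \<noteq> 0" and c: "\<And>i. c i \<noteq> 0"
  shows "op_scale a (op_Lambda :: 'n oper) \<in> gen_algebra (x_gen p c)"
proof -
  define js where "js = rev [0..<CARD('n)]"
  define e where "e = prod_list (map (\<lambda>j. c (of_nat j)) js) * p powi (int CARD('n) - 1)"
  have "e \<noteq> 0"
    using p c by (auto simp: e_def prod_list_zero_iff)
  have "op_prod (map (x_gen p c) (map of_nat js))
      = op_scale (prod_list (map (\<lambda>j. c (of_nat j)) js)) (op_prod (map (\<lambda>j. x_check p (of_nat j)) js))"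
    unfolding map_map x_gen_def comp_def by (rule op_prod_op_scale) (rule linear_oper_x_check)
  also have "\<dots> = op_scale e op_Lambda"
    by (simp only: js_def op_Lambda_eq_descending[OF p] op_scale_op_scale e_def)
  finally have "op_scale e op_Lambda \<in> gen_algebra (x_gen p c)"
    using gen_algebra_word[of "x_gen p c" "map of_nat js"] by simp
  then have "op_scale (a / e) (op_scale e op_Lambda) \<in> gen_algebra (x_gen p c)"
    by (rule gen_algebra.scale)
  then show ?thesis
    using \<open>e \<noteq> 0\<close> by simp
qed

lemma map_map_lambda: "map f (map g xs) = map (\<lambda>x. f (g x)) xs"
  by simp

lemma A_L_eq: "A_L q = product_L q (x_check q) \<circ> op_phi q op_Lambda"
  by (simp only: A_L_def product_L_def e_word_def map_map_lambda list.map op_prod_Cons op_prod_Nil comp_id)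

lemma A_R_eq: "A_R q d db = op_phi q (op_scale (q powi (1 - int CARD('n)) * D_N d db) op_Lambda)
    \<circ> product_R q (x_hat q d db)" for d db :: "'n::nontriv mod_ring \<Rightarrow> complex"
  by (simp only: A_R_def product_R_def e_word_def map_map_lambda rev_map list.map op_prod_Cons op_prod_Nil comp_id
      comp_assoc)

lemma cyclic_generators_shift:
  assumes "cyclic_generators q p G"
  shows "cyclic_generators q p (\<lambda>i. G (i + 1))"
proof -
  interpret cyclic_generators q p G by fact
  have weight: "commutation_weight (i + 1) (j + 1) = commutation_weight i j" for i j :: "'a mod_ring"
    by (simp only: commutation_weight_def add_right_cancel)
  show ?thesis
  proof
    show "G (i + 1) \<circ> G (j + 1)
        = op_scale (p powi commutation_weight i j) (G (j + 1) \<circ> G (i + 1))" for i j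
      using comm[of "i + 1" "j + 1"] unfolding weight .
  qed (rule norm_q p_nonzero linear raises)+
qed

lemma product_L_shift: "cyclic_generators q q G \<Longrightarrow> product_L q (\<lambda>i. G (i + 1)) = product_L q G"
  by (drule product_L_rotate[OF cyclic_generators_shift]) simp

lemma product_R_shift:
  "cyclic_generators q (inverse q) G \<Longrightarrow> product_R q (\<lambda>i. G (i + 1)) = product_R q G"
  by (drule product_R_rotate[OF cyclic_generators_shift]) simp

text \<open>Conjugation by \<^term>\<open>twist u\<close> realises the cyclic shift of generators whose scalar factors
  \<open>c\<close> may depend on the index, when \<open>u\<close> is chosen as the ratio of consecutive factors.\<close>

lemma shift_conjugation:
  fixes c c' :: "'n::nontriv mod_ring \<Rightarrow> complex"
  assumes q: "norm q < 1" and u: "\<And>i. u i \<noteq> 0" "prod u UNIV = 1"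
    and c: "\<And>i. c i * u (i + 1) = c' (i + 1)"
  defines "C \<equiv> conjugation.conjugate (twist u) (twist_inv u)"
  shows "p \<noteq> 0 \<Longrightarrow> C (x_gen p c i) = x_gen p c' (i + 1)"
    and "C (op_phi q (op_scale a op_Lambda)) = op_phi q (op_scale a op_Lambda)"
    and "q \<noteq> 0 \<Longrightarrow> C (product_L q (x_gen q c)) = product_L q (x_gen q c')"
    and "q \<noteq> 0 \<Longrightarrow> C (product_R q (x_gen (inverse q) c)) = product_R q (x_gen (inverse q) c')"
proof -
  interpret conjugation "twist u" "twist_inv u"
    using u(1) by (rule conjugation_twist)
  show gen: "C (x_gen p c i) = x_gen p c' (i + 1)" if "p \<noteq> 0" for p i
    unfolding C_def using twist_x_gen[of u c i c' p] linear(1) c by (intro conjugate_eqI) simp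
  have "conjugate op_Lambda = op_Lambda"
    by (intro conjugate_eqI twist_op_Lambda u(2))
  then show "C (op_phi q (op_scale a op_Lambda)) = op_phi q (op_scale a op_Lambda)"
    unfolding C_def op_phi_def
    by (simp only: conjugate_op_series raises_degree_op_scale raises_degree_op_Lambda conjugate_op_scale)
  show "C (product_L q (x_gen q c)) = product_L q (x_gen q c')" if "q \<noteq> 0"
  proof -
    \<comment> \<open>Conjugation shifts every generator, and \<open>product_L_shift\<close> then
      removes the shift.\<close>
    have "C (product_L q (x_gen q c)) = product_L q (\<lambda>i. x_gen q c' (i + 1))"
      unfolding C_def conjugate_product(1)[OF cyclic_generators.raises[OF cyclic_generators_x_gen[OF q that]]]
        gen[unfolded C_def, OF that] ..
    then show ?thesis
      by (simp only: product_L_shift[OF cyclic_generators_x_gen[OF q that]])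
  qed
  show "C (product_R q (x_gen (inverse q) c)) = product_R q (x_gen (inverse q) c')" if "q \<noteq> 0"
  proof -
    from that have p: "inverse q \<noteq> 0" by simp
    have "C (product_R q (x_gen (inverse q) c)) = product_R q (\<lambda>i. x_gen (inverse q) c' (i + 1))"
      unfolding C_def conjugate_product(2)[OF cyclic_generators.raises[OF cyclic_generators_x_gen[OF q p]]]
        gen[unfolded C_def, OF p] ..
    then show ?thesis
      by (simp only: product_R_shift[OF cyclic_generators_x_gen[OF q p]])
  qed
qed

section \<open>The Hamiltonian\<close>

lemma inv_relabel: "inv_into UNIV relabel = (twist_inv (\<lambda>_. 1) :: 'n::nontriv oper)"
proof (rule inv_unique_comp)
  interpret conjugation "twist (\<lambda>_. 1) :: 'n oper" "twist_inv (\<lambda>_. 1)"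
    by (rule conjugation_twist) simp
  have "relabel = (twist (\<lambda>_. 1) :: 'n oper)"
    by (simp add: fun_eq_iff relabel_def twist_def)
  then show "relabel \<circ> twist_inv (\<lambda>_. 1) = (id :: 'n oper)" "twist_inv (\<lambda>_. 1) \<circ> relabel = (id :: 'n oper)"
    using inverse by simp_all
qed

lemma relabel_eq_twist: "relabel = twist (\<lambda>_. 1)"
  by (simp add: fun_eq_iff relabel_def twist_def)

interpretation relabel: conjugation "twist (\<lambda>_. 1)" "twist_inv (\<lambda>_. 1)"
  by (rule conjugation_twist) simp

lemma relabel_op_eq: "relabel_op T = relabel.conjugate T"
  by (simp only: relabel_op_def relabel.conjugate_def inv_relabel) (simp only: relabel_eq_twist)

lemma relabel_op_diag: "relabel.conjugate (op_diag h) = op_diag (\<lambda>m. h (\<lambda>i. m (i + 1)))"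
  by (rule relabel.conjugate_eqI) (rule twist_op_diag)

lemma relabel_op_q_half_Delta:
  "relabel.conjugate (op_q_half_Delta logq) = (op_q_half_Delta logq :: 'n::nontriv oper)"
proof -
  have "Delta_expo (\<lambda>i. m (i + 1)) = Delta_expo m" for m :: "'n expo"
    using sum_shift_mod_ring[of "\<lambda>i. (of_nat (m i) - of_nat (m (i - 1)) :: complex) ^ 2"]
    by (simp add: Delta_expo_def)
  then show ?thesis
    by (simp add: op_q_half_Delta_def relabel_op_diag)
qed

lemma relabel_op_shift:
  fixes b :: "'n::nontriv mod_ring \<Rightarrow> complex"
  shows "relabel.conjugate (op_shift \<kappa> (\<lambda>i. b (i + 1))) = op_shift \<kappa> b"
proof -
  have "(\<Prod>i\<in>UNIV. (\<kappa> * b (i + 1) / b (i + 1 + 1)) ^ m (i + 1)) = (\<Prod>i\<in>UNIV. (\<kappa> * b i / b (i + 1)) ^ m i)"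
    for m :: "'n expo"
    by (rule prod_shift_mod_ring[of "\<lambda>i. (\<kappa> * b i / b (i + 1)) ^ m i"])
  then show ?thesis
    by (simp add: op_shift_def relabel_op_diag)
qed

section \<open>Relabelling of the commuting middle factor\<close>

lemma linear_oper_op_var: "linear_oper (op_var i)"
  by (auto simp: linear_oper_def fun_eq_iff op_var_def)

lemma raises_degree_op_var: "raises_degree 1 (op_var i)" for i :: "'n::nontriv mod_ring"
  unfolding raises_degree_def
proof (intro allI impI)
  fix k and g :: "'n pser" and m :: "'n expo"
  assume "\<forall>m. degree_expo m < k \<longrightarrow> g m = 0" and "degree_expo m < k + 1"
  then have "m i \<noteq> 0 \<Longrightarrow> g (m(i := m i - 1)) = 0"
    using degree_expo_decrement[of m i] by simp
  then show "op_var i g m = 0"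
    by (simp add: op_var_def)
qed

lemma op_var_commute: "op_var i \<circ> op_var j = op_var j \<circ> op_var i"
  by (cases "i = j") (auto simp: fun_eq_iff op_var_def fun_upd_twist)

lemma op_e_op_var_commute:
  "op_e q (op_scale a (op_var i)) \<circ> op_e q (op_scale b (op_var j))
    = op_e q (op_scale b (op_var j)) \<circ> op_e q (op_scale a (op_var i))"
  for i j :: "'n::nontriv mod_ring"
  unfolding op_e_def
proof (intro op_series_commute raises_degree_op_scale raises_degree_op_var linear_oper_op_scale linear_oper_op_var)
  show "op_scale a (op_var i) \<circ> op_scale b (op_var j) = op_scale b (op_var j) \<circ> op_scale a (op_var i)"
    by (simp only: op_scale_comp comp_op_scale[OF linear_oper_op_var] op_scale_op_scale
        op_var_commute[of i j] mult.commute)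
qed

text \<open>After relabelling the product runs from 2 to N + 1. Its last index is 1 modulo N, and
  that factor can move to the front because the exponentials of multiples of the variables
  commute.\<close>

lemma relabel_A_C:
  fixes d db :: "'n::nontriv mod_ring \<Rightarrow> complex"
  shows "relabel.conjugate (A_C q (\<lambda>i. d (i + 1)) (\<lambda>i. db (i + 1))) = A_C q d db"
proof -
  let ?N = "CARD('n)"
  define f where "f i = op_e q (op_scale (d i) (op_var i)) \<circ> op_e q (op_scale (db i) (op_var i))" for i
  have f_commute: "f i \<circ> f j = f j \<circ> f i" for i j
  proof -
    note c = op_e_op_var_commute[of q _ i _ j]
    have "f i \<circ> f j = f j \<circ> f i" if "i \<noteq> j"
      unfolding f_def by (metis (no_types, lifting) c comp_assoc)
    then show ?thesis by (cases "i = j") simp_all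
  qed
  have var: "relabel.conjugate (op_var i) = op_var (i + 1)" for i :: "'n mod_ring"
    by (rule relabel.conjugate_eqI) (simp add: twist_op_var)
  have e: "relabel.conjugate (op_e q (op_scale a (op_var i))) = op_e q (op_scale a (op_var (i + 1)))"
    for a and i :: "'n mod_ring"
    by (simp only: op_e_def relabel.conjugate_op_series raises_degree_op_scale raises_degree_op_var
        relabel.conjugate_op_scale var)
  have "relabel.conjugate (A_C q (\<lambda>i. d (i + 1)) (\<lambda>i. db (i + 1)))
      = op_prod (map (\<lambda>k. f (of_nat k + 1)) [1..<?N + 1])"
    by (simp only: A_C_def relabel.conjugate_op_prod map_map comp_def f_def)
      (simp only: comp_def[symmetric] relabel.conjugate_comp e)
  also have "map (\<lambda>k. f (of_nat k + 1)) [1..<?N + 1] = map (\<lambda>k. f (of_nat k)) (map Suc [1..<?N + 1])"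
    by (simp add: comp_def add.commute del: upt_Suc)
  also have "map Suc [1..<?N + 1] = [2..<?N + 1] @ [?N + 1]"
    by (simp add: map_Suc_upt numeral_2_eq_2)
  also have "op_prod (map (\<lambda>k. f (of_nat k)) ([2..<?N + 1] @ [?N + 1]))
      = op_prod (map (\<lambda>k. f (of_nat k)) [2..<?N + 1]) \<circ> f 1"
    by (simp only: map_append op_prod_append list.map op_prod_Cons op_prod_Nil comp_id of_nat_add of_nat_card_eq_0
        add_0_left of_nat_1)
  also have "\<dots> = f 1 \<circ> op_prod (map (\<lambda>k. f (of_nat k)) [2..<?N + 1])"
    by (rule monoid_list.F_commute[OF monoid_list_comp, where y = "f 1", unfolded monoid_list_comp_F, symmetric])
      (auto simp only: set_map f_commute)
  also have "\<dots> = op_prod (map (\<lambda>k. f (of_nat k)) (1 # [2..<?N + 1]))"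
    by (simp only: list.map op_prod_Cons of_nat_1)
  also have "1 # [2..<?N + 1] = [1..<?N + 1]"
    using nontriv[where ?'a = 'n] by (simp add: upt_conv_Cons numeral_2_eq_2)
  finally show ?thesis
    by (simp only: A_C_def f_def)
qed

theorem proposition2p4:
  fixes q logq \<kappa> :: complex
    and b d db :: "'n::nontriv mod_ring \<Rightarrow> complex"
  assumes "0 < norm q" and "norm q < 1" and "exp logq = q"
    and "\<kappa> \<noteq> 0" and "\<And>i. b i \<noteq> 0" and "\<And>i. d i \<noteq> 0" and "\<And>i. db i \<noteq> 0"
  shows
    "(A_L q :: 'n oper) \<in> completed_algebra (x_check q) \<and>
     (\<exists>\<pi>. cyclic_shift_automorphism (x_check q :: 'n mod_ring \<Rightarrow> 'n oper) \<pi>) \<and>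
     (\<forall>\<pi>. cyclic_shift_automorphism (x_check q :: 'n mod_ring \<Rightarrow> 'n oper) \<pi> \<longrightarrow>
          \<pi> (A_L q) = A_L q) \<and>
     A_R q d db \<in> completed_algebra (x_hat q d db) \<and>
     (\<exists>\<pi>. cyclic_shift_automorphism (x_hat q d db) \<pi>) \<and>
     (\<forall>\<pi>. cyclic_shift_automorphism (x_hat q d db) \<pi> \<longrightarrow>
          \<pi> (A_R q d db) = A_R q d db) \<and>
     relabel_op (Hamiltonian q logq \<kappa> (\<lambda>i. b (i + 1)) (\<lambda>i. d (i + 1)) (\<lambda>i. db (i + 1)))
       = Hamiltonian q logq \<kappa> b d db"
proof -
  from assms(1) have q: "q \<noteq> 0" and p: "inverse q \<noteq> 0" by auto
  note norm_q = assms(2)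
  let ?X = "x_check q :: 'n mod_ring \<Rightarrow> 'n oper"
  note gen_check = cyclic_generators_x_gen[OF norm_q q, of "\<lambda>_ :: 'n mod_ring. 1", folded x_check_eq_x_gen]
  note gen_hat = cyclic_generators_x_gen[OF norm_q p, of "\<lambda>i. d i * db i", folded x_hat_eq_x_gen]
  note linear_check = cyclic_generators.linear[OF gen_check] and raises_check = cyclic_generators.raises[OF gen_check]
  note linear_hat = cyclic_generators.linear[OF gen_hat] and raises_hat = cyclic_generators.raises[OF gen_hat]
  have phi_completed: "op_phi q (op_scale a op_Lambda) \<in> completed_algebra (x_gen r c)"
    if "r \<noteq> 0" "\<And>i. c i \<noteq> 0" for a r and c :: "'n mod_ring \<Rightarrow> complex"
    unfolding op_phi_def
  proof (rule completed_algebra_op_series)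
    note gen = cyclic_generators_x_gen[OF norm_q that(1), of c]
    show "linear_oper (x_gen r c i)" "raises_degree 1 (x_gen r c i)" for i
      by (rule cyclic_generators.linear[OF gen] cyclic_generators.raises[OF gen])+
    show "op_scale a op_Lambda \<in> gen_algebra (x_gen r c)"
      using that by (rule op_scale_op_Lambda_in_gen_algebra)
    show "raises_degree 1 (op_scale a op_Lambda :: 'n oper)"
      by (intro raises_degree_op_scale raises_degree_op_Lambda)
  qed
  have A_L: "A_L q = product_L q ?X \<circ> op_phi q (op_scale 1 op_Lambda)"
    by (simp only: A_L_eq op_scale_1)

  have one: "(1 :: complex) \<noteq> 0" and prod_one: "prod (\<lambda>_ :: 'n mod_ring. 1 :: complex) UNIV = 1"
    by simp_all
  \<comment> \<open>With \<open>u = 1\<close> the conjugation is the relabelling. It keeps the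
    scalar factors in \<open>shift_check\<close>, whereas \<open>shift_relabel\<close> starts from
    shifted parameters and ends with the original ones.\<close>
  note shift_one = shift_conjugation[OF norm_q, of "\<lambda>_ :: 'n mod_ring. 1", OF one prod_one]
  note shift_check = shift_one[of "\<lambda>_. 1" "\<lambda>_. 1", OF mult_1_right]
  note shift_relabel = shift_one[of "\<lambda>i. d (i + 1) * db (i + 1)" "\<lambda>i. d i * db i", OF mult_1_right]

  have A_L_completed: "(A_L q :: 'n oper) \<in> completed_algebra ?X"
    unfolding A_L using phi_completed[of q "\<lambda>_. 1"] q
    by (intro completed_algebra_comp product_L_in_completed linear_check raises_check)
      (simp only: x_check_eq_x_gen not_False_eq_True one_neq_zero)
  have A_L_relabel: "relabel.conjugate (A_L q :: 'n oper) = A_L q"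
    unfolding A_L relabel.conjugate_comp x_check_eq_x_gen
    by (simp only: shift_check(2) shift_check(3)[OF q])
  have auto_check: "cyclic_shift_automorphism ?X relabel.conjugate"
    by (rule relabel.cyclic_shift_automorphism_conjugate) (simp only: x_check_eq_x_gen shift_check(1)[OF q])
  have unique_check: "\<pi> (A_L q) = A_L q" if "cyclic_shift_automorphism ?X \<pi>" for \<pi>
    using cyclic_shift_automorphism_unique[OF linear_check raises_check that auto_check A_L_completed] A_L_relabel
    by simp

  have A_R_completed: "A_R q d db \<in> completed_algebra (x_hat q d db)"
    unfolding A_R_eq using phi_completed[of "inverse q" "\<lambda>i. d i * db i"] p assms(6,7)
    by (intro completed_algebra_comp product_R_in_completed linear_hat raises_hat)
      (simp add: x_hat_eq_x_gen)
  \<comment> \<open>The ratio of consecutive factors makes the twist send each hatted generator to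
    the next one with its own factor; around the cycle these ratios multiply to 1.\<close>
  define u where "u = (\<lambda>i. d i * db i / (d (i - 1) * db (i - 1)))"
  have u: "u i \<noteq> 0" for i
    by (simp add: u_def assms(6,7))
  have "prod u UNIV = (\<Prod>i\<in>UNIV. d i * db i) / (\<Prod>i\<in>UNIV. d (i - 1) * db (i - 1))"
    unfolding u_def by (rule prod_dividef)
  also have "(\<Prod>i\<in>UNIV. d (i - 1) * db (i - 1)) = (\<Prod>i\<in>UNIV. d i * db i)"
    using prod_shift_mod_ring[of "\<lambda>i. d (i - 1) * db (i - 1)"] by simp
  also have "(\<Prod>i\<in>UNIV. d i * db i) / (\<Prod>i\<in>UNIV. d i * db i) = 1"
    by (simp add: assms(6,7))
  finally have prod_u: "prod u UNIV = 1" .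
  have c: "d i * db i * u (i + 1) = d (i + 1) * db (i + 1)" for i
    by (simp add: u_def assms(6,7))
  note shift_hat = shift_conjugation[OF norm_q u prod_u, of "\<lambda>i. d i * db i" "\<lambda>i. d i * db i", OF c]
  interpret twist: conjugation "twist u" "twist_inv u"
    using u by (rule conjugation_twist)
  have A_R_twist: "twist.conjugate (A_R q d db) = A_R q d db"
    unfolding A_R_eq twist.conjugate_comp x_hat_eq_x_gen
    by (simp only: shift_hat(2) shift_hat(4)[OF q])
  have auto_hat: "cyclic_shift_automorphism (x_hat q d db) twist.conjugate"
    by (rule twist.cyclic_shift_automorphism_conjugate) (simp only: x_hat_eq_x_gen shift_hat(1)[OF p])
  have unique_hat: "\<pi> (A_R q d db) = A_R q d db" if "cyclic_shift_automorphism (x_hat q d db) \<pi>" for \<pi>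
    using cyclic_shift_automorphism_unique[OF linear_hat raises_hat that auto_hat A_R_completed] A_R_twist
    by simp

  \<comment> \<open>The product over all indices is cyclically invariant, so the argument of the
    central factor of \<open>A_R\<close> keeps its scalar.\<close>
  have D_N: "D_N (\<lambda>i. d (i + 1)) (\<lambda>i. db (i + 1)) = D_N d db"
    unfolding D_N_def by (rule prod_shift_mod_ring[of "\<lambda>i. d i * db i"])
  have A_R_relabel: "relabel.conjugate (A_R q (\<lambda>i. d (i + 1)) (\<lambda>i. db (i + 1))) = A_R q d db"
    unfolding A_R_eq relabel.conjugate_comp x_hat_eq_x_gen D_N
    by (simp only: shift_relabel(2) shift_relabel(4)[OF q])
  have "relabel_op (Hamiltonian q logq \<kappa> (\<lambda>i. b (i + 1)) (\<lambda>i. d (i + 1)) (\<lambda>i. db (i + 1)))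
       = Hamiltonian q logq \<kappa> b d db"
    by (simp only: Hamiltonian_def relabel_op_eq relabel.conjugate_comp relabel_op_q_half_Delta A_L_relabel
        relabel_A_C A_R_relabel relabel_op_shift)
  with A_L_completed auto_check unique_check A_R_completed auto_hat unique_hat show ?thesis
    by blast
qed

end
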